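(* Let $N=1$, let $k\ge1$ be an integer, let $\mathbf A^+,\mathbf A^-\in\mathbb S^2$ and let $\vartheta$ be the angle between $\mathbf A^+$ and $\mathbf A^-$. If $\vartheta\in(0,\pi)$, then there exists $\alpha_k\in(0,1)$ such that for every $\alpha\in[\alpha_k,1]$ there are at least $k$ distinct smooth self-similar solutions $\{\mathbf m_j\}_{j=1}^k$ in $X(\mathbb R\times\mathbb R^+;\mathbb S^2)$ of (LLG$_\alpha$) with initial condition $\mathbf m^0_{\mathbf A^\pm}$. These solutions are characterized by a strictly increasing sequence of values $\{c_j\}_{j=1}^k$, with $c_k\to\infty$ as $k\to\infty$, such that $$\mathbf m_j=\mathcal R_j\mathbf m_{c_j,\alpha},\qquad(1)$$ where $\mathcal R_j\in SO(3)$. In particular $$\sqrt t\,\|\partial_x\mathbf m_j(\cdot,t)\|_{L^\infty}=c_j\quad\text{for all }t>0.\qquad(2)$$ Furthermore, if $\alpha=1$ and $\vartheta\in[0,\pi]$, then there is an infinite number of distinct smooth self-similar solutions $\{\mathbf m_j\}_{j\ge1}$ in $X(\mathbb R\times\mathbb R^+;\mathbb S^2)$ of (LLG$_1$) with initial condition $\mathbf m^0_{\mathbf A^\pm}$. These solutions are also characterized by a sequence $\{c_j\}_{j\ge1}$ such that (1) and (2) are satisfied (with $\alpha=1$). This sequence is explicitly given by $$c_{2\ell+1}=\ell\sqrt\pi+\frac{\vartheta}{2\sqrt\pi}\ \ (\ell\ge0),\qquad c_{2\ell}=\ell\sqrt\pi-\frac{\vartheta}{2\sqrt\pi}\ \ 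(\ell\ge1).$$
   Context: $\mathbb R^+=(0,\infty)$, $\mathbb R^-=(-\infty,0)$; $\mathbb S^2\subset\mathbb R^3$ is the unit sphere; $\chi_E$ is the characteristic function of $E$. For $\alpha\in[0,1]$ set $\beta=\sqrt{1-\alpha^2}$. In dimension one, (LLG$_\alpha$) is $\partial_t\mathbf m=\beta\,\mathbf m\times\partial_{xx}\mathbf m-\alpha\,\mathbf m\times(\mathbf m\times\partial_{xx}\mathbf m)$ for $\mathbf m:\mathbb R\times\mathbb R^+\to\mathbb S^2$. For $\mathbf A^\pm\in\mathbb S^2$, $\mathbf m^0_{\mathbf A^\pm}:=\mathbf A^+\chi_{\mathbb R^+}+\mathbf A^-\chi_{\mathbb R^-}$. $X(\mathbb R\times\mathbb R^+;\mathbb S^2)$ is the set of $v:\mathbb R\times\mathbb R^+\to\mathbb R^3$ with $|v|=1$ a.e., $v,\partial_xv\in L^1_{loc}$ and $\|v\|_X<\infty$, where $\|v\|_X=\sup_{t>0}\|v(t)\|_{L^\infty}+[v]_X$ and $$[v]_X=\sup_{t>0}\sqrt t\|\partial_xv(t)\|_{L^\infty}+\sup_{x\in\mathbb R,\,r>0}\Big(\frac1r\int_{(x-r,x+r)\times[0,r^2]}|\partial_yv(y,t)|^2\,dt\,dy\Big)^{1/2}.$$ For $c>0$ let $(\mathbf f,\mathbf p,\mathbf q)$ be the solution on $\mathbb R$ of the Serret--Frenet system $$\mathbf f'=ce^{-\alpha s^2/4}\mathbf p,\qquad \mathbf p'=-ce^{-\alpha s^2/4}\mathbf f+\tfrac{\beta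 s}2\mathbf q,\qquad\mathbf q'=-\tfrac{\beta s}2\mathbf p,$$ with $\mathbf f(0)=(1,0,0)$, $\mathbf p(0)=(0,1,0)$, $\mathbf q(0)=(0,0,1)$, and put $\mathbf m_{c,\alpha}(x,t):=\mathbf f(x/\sqrt t)$; this is a smooth solution of (LLG$_\alpha$). For $\alpha=1$ it is $\mathbf m_{c,1}(x,t)=(\cos(c\,\mathrm{Erf}(x/\sqrt t)),\sin(c\,\mathrm{Erf}(x/\sqrt t)),0)$ with $\mathrm{Erf}(s)=\int_0^se^{-\sigma^2/4}d\sigma$; this formula is also used for $c=0$, so $\mathbf m_{0,1}\equiv(1,0,0)$. A solution is self-similar if $\mathbf m(\lambda x,\lambda^2t)=\mathbf m(x,t)$ for all $\lambda>0$. A smooth solution with initial condition $\mathbf m^0$ is $\mathbf m\in C^\infty(\mathbb R\times\mathbb R^+;\mathbb S^2)$ satisfying (LLG$_\alpha$) with $\|(\mathbf m(t)-\mathbf m^0)\varphi\|_{L^1}\to0$ as $t\to0^+$ for all $\varphi\in C_0^\infty(\mathbb R)$. In the first part, the values $c_1<\dots<c_k$ are positive and may depend on $k$ and $\alpha\in[\alpha_k,1]$; "$c_k\to\infty$" refers to the largest of the $k$ values. *)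

theory Defs
  imports "HOL-Analysis.Analysis" "HOL-Probability.Essential_Supremum"
begin

text \<open>Functions on \<open>\<real> \<times> \<real>\<^sup>+\<close> are total functions on \<^typ>\<open>real \<times> real\<close>, written
  as functions of the pair \<open>(x, t)\<close>; only their values on \<open>half_plane\<close> are meaningful.\<close>

abbreviation half_plane :: "(real \<times> real) set" where
  "half_plane \<equiv> UNIV \<times> {0<..}"

text \<open>Smoothness on an open set: all iterated directional derivatives exist, are differentiable
  and continuous there.\<close>

primrec times_differentiable_on ::
    "nat \<Rightarrow> ('a::euclidean_space \<Rightarrow> 'b::euclidean_space) \<Rightarrow> 'a set \<Rightarrow> bool" where
  "times_differentiable_on 0 f S \<longleftrightarrow> continuous_on S f"
| "times_differentiable_on (Suc n) f S \<longleftrightarrow>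
     (\<forall>x\<in>S. f differentiable (at x)) \<and>
     (\<forall>v. times_differentiable_on n (\<lambda>x. frechet_derivative f (at x) v) S)"

definition smooth_on :: "('a::euclidean_space \<Rightarrow> 'b::euclidean_space) \<Rightarrow> 'a set \<Rightarrow> bool" where
  "smooth_on f S \<longleftrightarrow> (\<forall>n. times_differentiable_on n f S)"

definition test_function :: "'a::euclidean_space set \<Rightarrow> ('a \<Rightarrow> real) \<Rightarrow> bool" where
  "test_function U \<phi> \<longleftrightarrow> smooth_on \<phi> UNIV \<and>
     compact (closure {x. \<phi> x \<noteq> 0}) \<and> closure {x. \<phi> x \<noteq> 0} \<subseteq> U"

definition dx :: "(real \<times> real \<Rightarrow> 'a::real_normed_vector) \<Rightarrow> real \<times> real \<Rightarrow> 'a" where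
  "dx v = (\<lambda>(x, t). vector_derivative (\<lambda>y. v (y, t)) (at x))"

definition dt :: "(real \<times> real \<Rightarrow> 'a::real_normed_vector) \<Rightarrow> real \<times> real \<Rightarrow> 'a" where
  "dt v = (\<lambda>(x, t). vector_derivative (\<lambda>s. v (x, s)) (at t))"

definition LLG :: "real \<Rightarrow> (real \<times> real \<Rightarrow> real^3) \<Rightarrow> bool" where
  "LLG \<alpha> m \<longleftrightarrow> (\<forall>z\<in>half_plane.
     dt m z = sqrt (1 - \<alpha>\<^sup>2) *\<^sub>R cross3 (m z) (dx (dx m) z)
       - \<alpha> *\<^sub>R cross3 (m z) (cross3 (m z) (dx (dx m) z)))"

definition jump_data :: "real^3 \<Rightarrow> real^3 \<Rightarrow> real \<Rightarrow> real^3" where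
  "jump_data Ap Am x = indicator {0<..} x *\<^sub>R Ap + indicator {..<0} x *\<^sub>R Am"

definition attains_initial ::
    "(real \<Rightarrow> real^3) \<Rightarrow> (real \<times> real \<Rightarrow> real^3) \<Rightarrow> bool" where
  "attains_initial m0 m \<longleftrightarrow> (\<forall>\<phi>. test_function UNIV \<phi> \<longrightarrow>
     ((\<lambda>t. \<integral>\<^sup>+x. ennreal (norm (\<phi> x *\<^sub>R (m (x, t) - m0 x))) \<partial>lebesgue) \<longlongrightarrow> 0) (at_right 0))"

definition smooth_solution ::
    "real \<Rightarrow> (real \<Rightarrow> real^3) \<Rightarrow> (real \<times> real \<Rightarrow> real^3) \<Rightarrow> bool" where
  "smooth_solution \<alpha> m0 m \<longleftrightarrow>
     smooth_on m half_plane \<and> m ` half_plane \<subseteq> sphere 0 1 \<and> LLG \<alpha> m \<and> attains_initial m0 m"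

definition self_similar :: "(real \<times> real \<Rightarrow> real^3) \<Rightarrow> bool" where
  "self_similar m \<longleftrightarrow> (\<forall>r>0. \<forall>x. \<forall>t>0. m (r * x, r\<^sup>2 * t) = m (x, t))"

definition Linf_norm :: "(real \<Rightarrow> real^3) \<Rightarrow> ennreal" where
  "Linf_norm g = esssup lebesgue (\<lambda>x. ennreal (norm (g x)))"

definition locally_integrable :: "(real \<times> real \<Rightarrow> real^3) \<Rightarrow> bool" where
  "locally_integrable v \<longleftrightarrow>
     (\<forall>K. compact K \<and> K \<subseteq> half_plane \<longrightarrow> v absolutely_integrable_on K)"

text \<open>\<open>w\<close> is the distributional derivative \<open>\<partial>\<^sub>x v\<close> on the half plane.\<close>

definition weak_dx :: "(real \<times> real \<Rightarrow> real^3) \<Rightarrow> (real \<times> real \<Rightarrow> real^3) \<Rightarrow> bool" where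
  "weak_dx v w \<longleftrightarrow> (\<forall>\<phi>. test_function half_plane \<phi> \<longrightarrow>
     (LINT z|lebesgue. dx \<phi> z *\<^sub>R v z) = - (LINT z|lebesgue. \<phi> z *\<^sub>R w z))"

definition ennreal_sqrt :: "ennreal \<Rightarrow> ennreal" where
  "ennreal_sqrt a = (if a = \<infinity> then \<infinity> else ennreal (sqrt (enn2real a)))"

text \<open>The seminorm \<open>[v]\<^sub>X\<close>, as a function of \<open>w = \<partial>\<^sub>x v\<close>.\<close>

definition X_seminorm :: "(real \<times> real \<Rightarrow> real^3) \<Rightarrow> ennreal" where
  "X_seminorm w =
     (SUP t\<in>{0<..}. ennreal (sqrt t) * Linf_norm (\<lambda>x. w (x, t))) +
     (SUP (x, r)\<in>half_plane. ennreal_sqrt (ennreal (1 / r) *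
        (\<integral>\<^sup>+z\<in>{x - r<..<x + r} \<times> {0..r\<^sup>2}. ennreal ((norm (w z))\<^sup>2) \<partial>lebesgue)))"

definition X_norm :: "(real \<times> real \<Rightarrow> real^3) \<Rightarrow> (real \<times> real \<Rightarrow> real^3) \<Rightarrow> ennreal" where
  "X_norm v w = (SUP t\<in>{0<..}. Linf_norm (\<lambda>x. v (x, t))) + X_seminorm w"

text \<open>The weak derivative is determined only almost everywhere, whereas the norm takes a supremum
  over all times; \<open>\<exists>w\<close> picks a representative.\<close>

definition X_space :: "(real \<times> real \<Rightarrow> real^3) set" where
  "X_space = {v. (AE z in lebesgue. z \<in> half_plane \<longrightarrow> norm (v z) = 1) \<and> locally_integrable v \<and>
     (\<exists>w. locally_integrable w \<and> weak_dx v w \<and> X_norm v w < \<infinity>)}"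

definition serret_frenet ::
    "real \<Rightarrow> real \<Rightarrow> (real \<Rightarrow> real^3) \<times> (real \<Rightarrow> real^3) \<times> (real \<Rightarrow> real^3) \<Rightarrow> bool" where
  "serret_frenet c \<alpha> = (\<lambda>(f, p, q).
     (\<forall>s. (f has_vector_derivative (c * exp (- \<alpha> * s\<^sup>2 / 4)) *\<^sub>R p s) (at s) \<and>
          (p has_vector_derivative
             - ((c * exp (- \<alpha> * s\<^sup>2 / 4)) *\<^sub>R f s) + (sqrt (1 - \<alpha>\<^sup>2) * s / 2) *\<^sub>R q s) (at s) \<and>
          (q has_vector_derivative - ((sqrt (1 - \<alpha>\<^sup>2) * s / 2) *\<^sub>R p s)) (at s)) \<and>
     f 0 = vector [1, 0, 0] \<and> p 0 = vector [0, 1, 0] \<and> q 0 = vector [0, 0, 1])"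

text \<open>The linear system has exactly one global solution, so \<open>THE\<close> is well defined. For \<open>\<alpha> = 1\<close> its
  first component is \<open>(cos (c Erf s), sin (c Erf s), 0)\<close>, also for \<open>c = 0\<close>, where it is constant.\<close>

definition profile :: "real \<Rightarrow> real \<Rightarrow> real \<Rightarrow> real^3" where
  "profile c \<alpha> = fst (THE F. serret_frenet c \<alpha> F)"

definition m_ss :: "real \<Rightarrow> real \<Rightarrow> real \<times> real \<Rightarrow> real^3" where
  "m_ss c \<alpha> = (\<lambda>(x, t). profile c \<alpha> (x / sqrt t))"

text \<open>The angle between two unit vectors, in \<open>[0, \<pi>]\<close>.\<close>

definition unit_angle :: "real^3 \<Rightarrow> real^3 \<Rightarrow> real" where
  "unit_angle A B = arccos (A \<bullet> B)"

definition ss_solution ::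
    "real \<Rightarrow> real^3 \<Rightarrow> real^3 \<Rightarrow> (real \<times> real \<Rightarrow> real^3) \<Rightarrow> bool" where
  "ss_solution \<alpha> Ap Am m \<longleftrightarrow>
     m \<in> X_space \<and> smooth_solution \<alpha> (jump_data Ap Am) m \<and> self_similar m"

definition distinct_on_half_plane :: "nat set \<Rightarrow> (nat \<Rightarrow> real \<times> real \<Rightarrow> real^3) \<Rightarrow> bool" where
  "distinct_on_half_plane J m \<longleftrightarrow> (\<forall>i\<in>J. \<forall>j\<in>J. i \<noteq> j \<longrightarrow> (\<exists>z\<in>half_plane. m i z \<noteq> m j z))"

end

theory Submission
  imports Defs "HOL-Probability.Distributions" "HOL-Real_Asymp.Real_Asymp"
begin

text \<open>If \<open>(f, p, q)\<close> solves the Serret--Frenet system with an orthonormal initial frame, then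
  \<open>f (x / \<surd>t)\<close> solves the LLG equation, and since \<open>|f'| = c exp (-\<alpha> s\<^sup>2 / 4)\<close> is integrable, \<open>f\<close> has
  limits at \<open>\<plusminus>\<infinity>\<close>, which are the two values of the initial datum. Up to a rotation, the datum is
  therefore determined by the cosine \<open>end_cos c \<alpha>\<close> of the angle between the two limits. This function
  is jointly continuous and equals \<open>cos (2 c \<surd>\<pi>)\<close> for \<open>\<alpha> = 1\<close>; as this oscillates between \<open>\<plusminus>1\<close>, the
  intermediate value theorem gives \<open>k\<close> solutions \<open>c\<close> of \<open>end_cos c \<alpha> = cos \<theta>\<close> for every \<open>\<alpha>\<close>
  close enough to 1, while for \<open>\<alpha> = 1\<close> all solutions are explicit.\<close>

section \<open>Linear differential equations\<close>

text \<open>Curvature is even and torsion odd in s, so reversing s amounts to a half turn about the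
  first axis. This ties the limit at minus infinity to the one at plus infinity, and rotations do
  the rest, because two pairs of unit vectors with equal inner products differ by a rotation. The
  obstacle is joint continuity of a limit at infinity. For bounded c and \<alpha> bounded away from
  0 the tails decay at a common explicit rate, so the limit is uniform there. At finite s the
  torsion contains sqrt (1 - \<alpha>^2), which is continuous but not Lipschitz at \<alpha> = 1, so
  a mere modulus of continuity is carried along. The sign pattern at \<alpha> = 1 survives a
  perturbation because cos \<theta> lies strictly between -1 and 1; closeness of \<alpha> to 1 is
  secured at finitely many values of c only, hence a bound that depends on k. At \<alpha> = 1 the
  torsion vanishes and the curve is planar with total turning 2 c sqrt pi. This must equal \<theta>
  or -\<theta> modulo 2 pi, which gives the two interleaved families of values c.\<close>

lemma antiderivative_LBINT:
  fixes g :: "real \<Rightarrow> 'a::euclidean_space"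
  assumes "continuous_on UNIV g"
  shows "((\<lambda>u. LBINT y=0..u. g y) has_vector_derivative g s) (at s)"
proof -
  \<comment> \<open>Both 0 and \<open>s\<close> are interior to \<open>{- b..b}\<close>, so negative
    \<open>s\<close> needs no case of its own and the derivative is two-sided.\<close>
  define b where "b = \<bar>s\<bar> + 1"
  have "((\<lambda>u. LBINT y=0..u. g y) has_vector_derivative g s) (at s within {- b..b})"
    by (rule interval_integral_FTC2[of "-b" 0 b g s, unfolded zero_ereal_def[symmetric]])
      (auto simp: b_def intro: continuous_on_subset[OF assms])
  moreover have "s \<in> interior {- b..b}"
    by (auto simp: b_def)
  ultimately show ?thesis
    by (metis at_within_interior)
qed

text \<open>One round of the Picard estimate: the mean value inequality against the primitive of the
  bound. The divisors \<open>Suc n\<close> accumulate to the factorial.\<close>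

lemma norm_bound_power_step:
  fixes g :: "real \<Rightarrow> 'a::real_normed_vector"
  assumes "0 \<le> s" and "g 0 = 0"
    and "\<And>\<sigma>. (g has_vector_derivative g' \<sigma>) (at \<sigma>)"
    and "\<And>\<sigma>. 0 < \<sigma> \<Longrightarrow> \<sigma> < s \<Longrightarrow> norm (g' \<sigma>) \<le> C * \<sigma> ^ n"
  shows "norm (g s) \<le> C * s ^ Suc n / real (Suc n)"
proof (cases "s = 0")
  case False
  have "norm (g s - g 0) \<le> C * s ^ Suc n / real (Suc n) - C * 0 ^ Suc n / real (Suc n)"
  proof (rule differentiable_bound_general[where \<phi>' = "\<lambda>\<sigma>. C * \<sigma> ^ n"])
    show "((\<lambda>\<sigma>. C * \<sigma> ^ Suc n / real (Suc n)) has_vector_derivative C * x ^ n) (at x)" for x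
      unfolding has_real_derivative_iff_has_vector_derivative[symmetric]
      by (rule derivative_eq_intros refl | simp)+
    show "continuous_on {0..s} g"
      using assms(3) has_vector_derivative_continuous
      by (blast intro: continuous_at_imp_continuous_on)
    show "continuous_on {0..s} (\<lambda>\<sigma>. C * \<sigma> ^ Suc n / real (Suc n))"
      by (intro continuous_intros) auto
  qed (use assms False in auto)
  then show ?thesis
    using assms by simp
qed (use assms in auto)

text \<open>Picard iteration written as a series, each term being the integral of \<open>A\<close>
  applied to the previous one. On every bounded interval the terms are dominated by an exponential
  series, so the sum is a global solution without any continuation argument.\<close>

theorem linear_ode_solution:
  fixes A :: "real \<Rightarrow> 'a::euclidean_space \<Rightarrow>\<^sub>L 'a"
  assumes A: "continuous_on UNIV A"
  obtains y where "y 0 = y0" and "\<And>s. (y has_vector_derivative A s (y s)) (at s)"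
proof -
  define Y where "Y = rec_nat (\<lambda>s. y0) (\<lambda>n y s. LBINT \<sigma>=0..ereal s. A \<sigma> (y \<sigma>))"
  have Y0: "Y 0 = (\<lambda>s. y0)" and YS: "Y (Suc n) = (\<lambda>s. LBINT \<sigma>=0..ereal s. A \<sigma> (Y n \<sigma>))" for n
    by (simp_all add: Y_def)
  \<comment> \<open>The derivative of the term \<open>Y n\<close>. Its shift by one index makes the
    series of derivatives sum to \<open>A\<close> applied to the whole series.\<close>
  define D where "D n s = (case n of 0 \<Rightarrow> 0 | Suc k \<Rightarrow> A s (Y k s))" for n s
  have D: "D 0 s = 0" "D (Suc n) s = A s (Y n s)" for n s
    by (simp_all add: D_def)
  have Yderiv: "(Y n has_vector_derivative D n s) (at s)" and Ycont: "continuous_on UNIV (Y n)" for n s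
  proof (induction n arbitrary: s)
    case 0
    { case 1 show ?case by (simp add: Y0 D)
    next case 2 show ?case by (simp add: Y0) }
  next
    case (Suc n)
    have *: "(Y (Suc n) has_vector_derivative D (Suc n) s) (at s)" for s
      unfolding YS D by (intro antiderivative_LBINT continuous_intros A Suc.IH(2))
    { case 1 show ?case by (rule *)
    next case 2 show ?case
        using * has_vector_derivative_continuous by (blast intro: continuous_at_imp_continuous_on) }
  qed
  have Yzero: "Y (Suc n) 0 = 0" for n
    by (simp add: YS zero_ereal_def[symmetric])
  have bound: "norm (Y n s) \<le> norm y0 * (K * \<bar>s\<bar>) ^ n / fact n"
    if K: "\<And>s. \<bar>s\<bar> \<le> L \<Longrightarrow> norm (A s) \<le> K" and "\<bar>s\<bar> \<le> L" for K L s n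
    using that(2)
  proof (induction n arbitrary: s)
    case 0
    then show ?case by (simp add: Y0)
  next
    case (Suc n)
    define C where "C = norm y0 * K ^ Suc n / fact n"
    have "0 \<le> K"
      using order_trans[OF norm_ge_zero K[of 0]] Suc.prems by auto
    have Dn: "norm (D (Suc n) \<sigma>) \<le> C * \<bar>\<sigma>\<bar> ^ n" if "\<bar>\<sigma>\<bar> \<le> L" for \<sigma>
    proof -
      have "norm (D (Suc n) \<sigma>) \<le> norm (A \<sigma>) * norm (Y n \<sigma>)"
        unfolding D by (rule norm_blinfun)
      also have "\<dots> \<le> K * (norm y0 * (K * \<bar>\<sigma>\<bar>) ^ n / fact n)"
        using K[OF that] Suc.IH[OF that] \<open>0 \<le> K\<close> by (intro mult_mono) auto
      also have "\<dots> = C * \<bar>\<sigma>\<bar> ^ n"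
        by (simp add: C_def power_mult_distrib)
      finally show ?thesis .
    qed
    have "norm (Y (Suc n) s) \<le> C * \<bar>s\<bar> ^ Suc n / real (Suc n)"
    proof (cases "0 \<le> s")
      case True
      have "norm (Y (Suc n) s) \<le> C * s ^ Suc n / real (Suc n)"
      proof (rule norm_bound_power_step[OF True Yzero Yderiv])
        show "norm (D (Suc n) \<sigma>) \<le> C * \<sigma> ^ n" if "0 < \<sigma>" "\<sigma> < s" for \<sigma>
          using Dn[of \<sigma>] that Suc.prems by auto
      qed
      then show ?thesis using True by simp
    next
      case False
      \<comment> \<open>The double minus presents the value as that of the reflected term at the
        positive point \<open>- s\<close>, where the step lemma applies.\<close>
      have "norm (Y (Suc n) (- (- s))) \<le> C * (- s) ^ Suc n / real (Suc n)"
      proof (rule norm_bound_power_step[where g = "\<lambda>\<sigma>. Y (Suc n) (- \<sigma>)"])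
        show "((\<lambda>\<sigma>. Y (Suc n) (- \<sigma>)) has_vector_derivative - D (Suc n) (- \<sigma>)) (at \<sigma>)" for \<sigma>
          using vector_diff_chain_at[of uminus "-1" \<sigma> "Y (Suc n)", OF _ Yderiv]
            has_vector_derivative_minus[OF has_vector_derivative_id]
          by (simp add: o_def)
        show "norm (- D (Suc n) (- \<sigma>)) \<le> C * \<sigma> ^ n" if "0 < \<sigma>" "\<sigma> < - s" for \<sigma>
          using Dn[of "- \<sigma>"] that Suc.prems by auto
      qed (use False Yzero in auto)
      then show ?thesis using False by simp
    qed
    also have "C * \<bar>s\<bar> ^ Suc n / real (Suc n) = norm y0 * (K * \<bar>s\<bar>) ^ Suc n / fact (Suc n)"
      by (simp add: C_def power_mult_distrib field_simps)
    finally show ?case .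
  qed
  define y where "y s = (\<Sum>n. Y n s)" for s
  have "(y has_vector_derivative A s (y s)) (at s)" for s
  proof -
    define L where "L = \<bar>s\<bar> + 1"
    have "compact (A ` {- L..L})"
      by (intro compact_continuous_image continuous_on_subset[OF A]) auto
    then obtain K where K0: "\<forall>x\<in>A ` {- L..L}. norm x \<le> K"
      using compact_imp_bounded bounded_iff by blast
    then have K: "norm (A x) \<le> K" if "\<bar>x\<bar> \<le> L" for x
      using that by (auto simp: abs_le_iff)
    have "0 \<le> K"
      using order_trans[OF norm_ge_zero K[of 0]] L_def by auto
    define M where "M n = norm y0 * (K * L) ^ n / fact n" for n
    have M: "norm (Y n x) \<le> M n" if "\<bar>x\<bar> \<le> L" for n x
    proof -
      have "norm (Y n x) \<le> norm y0 * (K * \<bar>x\<bar>) ^ n / fact n"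
        by (rule bound[OF K that])
      also have "\<dots> \<le> M n"
        unfolding M_def using that \<open>0 \<le> K\<close>
        by (intro divide_right_mono mult_left_mono power_mono mult_nonneg_nonneg) auto
      finally show ?thesis .
    qed
    have sM: "summable M"
      unfolding M_def using summable_mult[OF summable_exp[of "K * L"], of "norm y0"]
      by (simp add: field_simps)
    have sY: "summable (\<lambda>n. Y n x)" if "\<bar>x\<bar> \<le> L" for x
      by (rule summable_comparison_test'[OF sM, of 0]) (use M that in auto)
    have sumD: "(\<lambda>n. D n x) sums A x (y x)" if "\<bar>x\<bar> \<le> L" for x
    proof -
      have "(\<lambda>n. A x (Y n x)) sums A x (y x)"
        unfolding y_def using sY[OF that] by (intro bounded_linear.sums[OF blinfun.bounded_linear_right] summable_sums)
      then show ?thesis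
        by (subst (asm) D(2)[symmetric], subst (asm) sums_Suc_iff) (simp add: D(1))
    qed
    have unif: "uniform_limit {- L..L} (\<lambda>n x. \<Sum>i<n. D i x) (\<lambda>x. \<Sum>i. D i x) sequentially"
    proof (rule Weierstrass_m_test)
      show "norm (D n x) \<le> (case n of 0 \<Rightarrow> 0 | Suc k \<Rightarrow> K * M k)" if "x \<in> {- L..L}" for n x
      proof (cases n)
        case (Suc k)
        have "norm (A x (Y k x)) \<le> norm (A x) * norm (Y k x)"
          by (rule norm_blinfun)
        also have "\<dots> \<le> K * M k"
          using K[of x] M[of x k] that \<open>0 \<le> K\<close> by (intro mult_mono) auto
        finally show ?thesis by (simp add: Suc D)
      qed (simp add: D)
      show "summable (\<lambda>n. case n of 0 \<Rightarrow> 0 | Suc k \<Rightarrow> K * M k)"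
        by (subst summable_Suc_iff[symmetric]) (simp add: sM)
    qed
    \<comment> \<open>Termwise differentiation on the whole interval; the margin 1 in
      \<open>L\<close> keeps \<open>s\<close> in its interior.\<close>
    have "\<exists>g. \<forall>x\<in>{- L..L}. (\<lambda>n. Y n x) sums g x \<and>
        (g has_derivative (\<lambda>h. h *\<^sub>R A x (y x))) (at x within {- L..L})"
    proof (rule has_derivative_series)
      show "(Y n has_derivative (\<lambda>h. h *\<^sub>R D n x)) (at x within {- L..L})" for n x
        using Yderiv[of n x] has_derivative_at_withinI by (auto simp: has_vector_derivative_def)
      show "\<forall>\<^sub>F n in sequentially. \<forall>x\<in>{- L..L}. \<forall>h.
          norm ((\<Sum>i<n. h *\<^sub>R D i x) - h *\<^sub>R A x (y x)) \<le> e * norm h" if "0 < e" for e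
        using uniform_limitD[OF unif that]
      proof (rule eventually_mono, intro ballI allI)
        fix n x and h :: real
        assume "\<forall>x\<in>{- L..L}. dist (\<Sum>i<n. D i x) (\<Sum>i. D i x) < e" and x: "x \<in> {- L..L}"
        then have "norm ((\<Sum>i<n. D i x) - A x (y x)) \<le> e"
          using sums_unique[OF sumD[of x]] by (auto simp: dist_norm abs_le_iff less_imp_le)
        then have "norm h * norm ((\<Sum>i<n. D i x) - A x (y x)) \<le> norm h * e"
          by (intro mult_left_mono) auto
        then show "norm ((\<Sum>i<n. h *\<^sub>R D i x) - h *\<^sub>R A x (y x)) \<le> e * norm h"
          by (simp add: scaleR_sum_right[symmetric] scaleR_diff_right[symmetric] mult.commute)
      qed
      show "(\<lambda>n. Y n s) sums y s"
        unfolding y_def using sY[of s] by (auto simp: L_def)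
    qed (auto simp: L_def)
    then obtain g where g: "\<And>x. x \<in> {- L..L} \<Longrightarrow> (\<lambda>n. Y n x) sums g x"
      "\<And>x. x \<in> {- L..L} \<Longrightarrow> (g has_vector_derivative A x (y x)) (at x within {- L..L})"
      unfolding has_vector_derivative_def by blast
    have s: "s \<in> interior {- L..L}"
      by (auto simp: L_def)
    have "(g has_vector_derivative A s (y s)) (at s)"
      using g(2)[of s] s at_within_interior[OF s] by (auto simp: L_def)
    then show ?thesis
      by (rule has_vector_derivative_transform_within_open[of _ _ _ "{- L<..<L}"])
        (use g(1) in \<open>auto simp: L_def y_def sums_iff\<close>)
  qed
  moreover have "y 0 = y0"
  proof -
    have "Y n 0 = (if n = 0 then y0 else 0)" for n
      using Yzero by (cases n) (auto simp: Y0)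
    then show ?thesis
      using suminf_finite[of "{0}" "\<lambda>n. Y n 0"] by (simp add: y_def)
  qed
  ultimately show ?thesis
    using that by blast
qed

section \<open>Serret--Frenet frames\<close>

definition curvature :: "real \<Rightarrow> real \<Rightarrow> real \<Rightarrow> real" where
  "curvature c \<alpha> s = c * exp (- \<alpha> * s\<^sup>2 / 4)"

definition torsion :: "real \<Rightarrow> real \<Rightarrow> real" where
  "torsion \<alpha> s = sqrt (1 - \<alpha>\<^sup>2) * s / 2"

lemma curvature_minus [simp]: "curvature c \<alpha> (- s) = curvature c \<alpha> s"
  by (simp add: curvature_def)

lemma torsion_minus [simp]: "torsion \<alpha> (- s) = - torsion \<alpha> s"
  by (simp add: torsion_def)

lemma curvature_nonneg: "0 \<le> c \<Longrightarrow> 0 \<le> curvature c \<alpha> s"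
  by (simp add: curvature_def)

lemma has_field_derivative_curvature:
  "(curvature c \<alpha> has_field_derivative - (\<alpha> * s / 2) * curvature c \<alpha> s) (at s)"
  unfolding curvature_def [abs_def]
  by (rule derivative_eq_intros refl | simp)+

lemma bounded_bilinear_cross3: "bounded_bilinear cross3"
  using bilinear_conv_bounded_bilinear bilinear_cross by blast

lemma has_field_derivative_inner:
  fixes f g :: "real \<Rightarrow> 'a::real_inner"
  assumes "(f has_vector_derivative f') (at s)" and "(g has_vector_derivative g') (at s)"
  shows "((\<lambda>s. f s \<bullet> g s) has_field_derivative f s \<bullet> g' + f' \<bullet> g s) (at s)"
  unfolding has_real_derivative_iff_has_vector_derivative
  by (rule bounded_bilinear.has_vector_derivative[OF bounded_bilinear_inner assms])

lemma has_vector_derivative_reflect: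
  assumes "(f has_vector_derivative f') (at (- s))"
  shows "((\<lambda>s. f (- s)) has_vector_derivative - f') (at s)"
  using vector_diff_chain_at[of uminus "-1" s f, OF _ assms]
    has_vector_derivative_minus[OF has_vector_derivative_id]
  by (simp add: o_def)

text \<open>The initial values are left open: reflected frames, rotated frames and the cross
  products of a frame all have to be recognised as solutions of the same system.\<close>

locale frenet =
  fixes c \<alpha> :: real and f p q :: "real \<Rightarrow> real^3"
  assumes deriv_f: "(f has_vector_derivative curvature c \<alpha> s *\<^sub>R p s) (at s)"
    and deriv_p: "(p has_vector_derivative
          - (curvature c \<alpha> s *\<^sub>R f s) + torsion \<alpha> s *\<^sub>R q s) (at s)"
    and deriv_q: "(q has_vector_derivative - (torsion \<alpha> s *\<^sub>R p s)) (at s)"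

lemma serret_frenet_iff:
  "serret_frenet c \<alpha> (f, p, q) \<longleftrightarrow> frenet c \<alpha> f p q \<and>
    f 0 = vector [1, 0, 0] \<and> p 0 = vector [0, 1, 0] \<and> q 0 = vector [0, 0, 1]"
  unfolding serret_frenet_def frenet_def curvature_def torsion_def by auto

lemma frenet_exists:
  obtains f p q where "frenet c \<alpha> f p q" and "f 0 = f0" and "p 0 = p0" and "q 0 = q0"
proof -
  \<comment> \<open>The constant skew generators that mix the first two and the last two vectors of
    a triple; curvature and torsion enter as scalar factors.\<close>
  define B1 B2 :: "((real^3) \<times> (real^3) \<times> (real^3)) \<Rightarrow>\<^sub>L ((real^3) \<times> (real^3) \<times> (real^3))"
    where "B1 \<equiv> Blinfun (\<lambda>x. (fst (snd x), - fst x, 0))"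
      and "B2 \<equiv> Blinfun (\<lambda>x. (0, snd (snd x), - fst (snd x)))"
  have B1: "blinfun_apply B1 x = (fst (snd x), - fst x, 0)"
    and B2: "blinfun_apply B2 x = (0, snd (snd x), - fst (snd x))" for x
    unfolding B1_def B2_def
    by (subst bounded_linear_Blinfun_apply,
        intro bounded_linear_intros bounded_linear_minus, simp)+
  define A where "A s = curvature c \<alpha> s *\<^sub>R B1 + torsion \<alpha> s *\<^sub>R B2" for s
  have "continuous_on UNIV A"
    unfolding A_def curvature_def torsion_def by (intro continuous_intros) auto
  from linear_ode_solution[OF this, of "(f0, p0, q0)"]
  obtain y where y: "y 0 = (f0, p0, q0)"
    and y': "\<And>s. (y has_vector_derivative A s (y s)) (at s)"
    by blast
  note y2 = bounded_linear.has_vector_derivative[OF bounded_linear_snd y']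
  have "frenet c \<alpha> (\<lambda>s. fst (y s)) (\<lambda>s. fst (snd (y s))) (\<lambda>s. snd (snd (y s)))"
    using bounded_linear.has_vector_derivative[OF bounded_linear_fst y']
      bounded_linear.has_vector_derivative[OF bounded_linear_fst y2]
      bounded_linear.has_vector_derivative[OF bounded_linear_snd y2]
    by unfold_locales (simp_all add: A_def blinfun.add_left blinfun.scaleR_left B1 B2)
  then show ?thesis
    using that y by simp
qed

text \<open>Both coefficient matrices are skew, so only their difference contributes.\<close>

lemma frenet_pairing_derivative:
  assumes "frenet c1 \<alpha>1 f1 p1 q1" and "frenet c2 \<alpha>2 f2 p2 q2"
  shows "((\<lambda>s. f1 s \<bullet> f2 s + p1 s \<bullet> p2 s + q1 s \<bullet> q2 s) has_field_derivative
      (curvature c1 \<alpha>1 s - curvature c2 \<alpha>2 s) * (p1 s \<bullet> f2 s - f1 s \<bullet> p2 s) +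
      (torsion \<alpha>1 s - torsion \<alpha>2 s) * (q1 s \<bullet> p2 s - p1 s \<bullet> q2 s)) (at s)"
proof -
  interpret A: frenet c1 \<alpha>1 f1 p1 q1 by fact
  interpret B: frenet c2 \<alpha>2 f2 p2 q2 by fact
  show ?thesis
    by (rule DERIV_cong[OF DERIV_add[OF DERIV_add[OF
        has_field_derivative_inner[OF A.deriv_f B.deriv_f]
        has_field_derivative_inner[OF A.deriv_p B.deriv_p]]
        has_field_derivative_inner[OF A.deriv_q B.deriv_q]]])
      (simp add: inner_simps algebra_simps)
qed

text \<open>For equal coefficients the pairing of any two solutions is constant. The squared
  distance of two solutions is a combination of three such pairings and so keeps its initial value
  0.\<close>

lemma frenet_unique:
  assumes "frenet c \<alpha> f1 p1 q1" and "frenet c \<alpha> f2 p2 q2"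
    and "f1 0 = f2 0" and "p1 0 = p2 0" and "q1 0 = q2 0"
  shows "f1 = f2 \<and> p1 = p2 \<and> q1 = q2"
proof -
  have const: "f s \<bullet> f' s + p s \<bullet> p' s + q s \<bullet> q' s = f 0 \<bullet> f' 0 + p 0 \<bullet> p' 0 + q 0 \<bullet> q' 0"
    if "frenet c \<alpha> f p q" "frenet c \<alpha> f' p' q'" for f p q f' p' q' s
    by (rule DERIV_isconst_all[of "\<lambda>s. f s \<bullet> f' s + p s \<bullet> p' s + q s \<bullet> q' s"])
      (use frenet_pairing_derivative[OF that] in simp)
  have "f1 s = f2 s \<and> p1 s = p2 s \<and> q1 s = q2 s" for s
  proof -
    have "(f1 s - f2 s) \<bullet> (f1 s - f2 s) + (p1 s - p2 s) \<bullet> (p1 s - p2 s)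
        + (q1 s - q2 s) \<bullet> (q1 s - q2 s) = 0"
      using const[OF assms(1,1), of s] const[OF assms(1,2), of s] const[OF assms(2,2), of s] assms(3-)
      by (simp add: inner_simps inner_commute)
    then have "(f1 s - f2 s) \<bullet> (f1 s - f2 s) = 0 \<and> (p1 s - p2 s) \<bullet> (p1 s - p2 s) = 0
        \<and> (q1 s - q2 s) \<bullet> (q1 s - q2 s) = 0"
      using inner_ge_zero[of "f1 s - f2 s"] inner_ge_zero[of "p1 s - p2 s"]
        inner_ge_zero[of "q1 s - q2 s"] by linarith
    then show ?thesis by simp
  qed
  then show ?thesis by auto
qed

text \<open>A positively oriented orthonormal frame is demanded at 0 only; the skew system carries
  it to every s.\<close>

locale frenet_frame = frenet +
  assumes norm_f_0: "norm (f 0) = 1" and norm_p_0: "norm (p 0) = 1"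
    and f_p_0: "f 0 \<bullet> p 0 = 0" and q_0: "q 0 = cross3 (f 0) (p 0)"
begin

text \<open>The three cross products solve the same system with the same initial values.\<close>

lemma cross_frame:
  "cross3 (p s) (q s) = f s" "cross3 (q s) (f s) = p s" "cross3 (f s) (p s) = q s"
proof -
  note D = bounded_bilinear.has_vector_derivative[OF bounded_bilinear_cross3]
  have "frenet c \<alpha> (\<lambda>s. cross3 (p s) (q s)) (\<lambda>s. cross3 (q s) (f s)) (\<lambda>s. cross3 (f s) (p s))"
  proof
    show "((\<lambda>s. cross3 (p s) (q s)) has_vector_derivative
        curvature c \<alpha> s *\<^sub>R cross3 (q s) (f s)) (at s)" for s
      by (rule has_vector_derivative_eq_rhs[OF D[OF deriv_p deriv_q]])
        (simp add: Cross3.left_diff_distrib cross_mult_left cross_mult_right cross_skew[of "f s" "q s"])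
    show "((\<lambda>s. cross3 (q s) (f s)) has_vector_derivative
        - (curvature c \<alpha> s *\<^sub>R cross3 (p s) (q s)) + torsion \<alpha> s *\<^sub>R cross3 (f s) (p s)) (at s)" for s
      by (rule has_vector_derivative_eq_rhs[OF D[OF deriv_q deriv_f]])
        (simp add: cross_mult_left cross_mult_right cross_skew[of "q s" "p s"]
          cross_skew[of "p s" "f s"])
    show "((\<lambda>s. cross3 (f s) (p s)) has_vector_derivative
        - (torsion \<alpha> s *\<^sub>R cross3 (q s) (f s))) (at s)" for s
      by (rule has_vector_derivative_eq_rhs[OF D[OF deriv_f deriv_p]])
        (simp add: Cross3.right_diff_distrib cross_mult_left cross_mult_right cross_skew[of "f s" "q s"])
  qed
  moreover have "cross3 (p 0) (q 0) = f 0"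
    unfolding q_0 Lagrange using f_p_0 norm_p_0 by (simp add: inner_commute norm_eq_1)
  moreover have "cross3 (q 0) (f 0) = p 0"
    unfolding q_0 cross_skew[of _ "f 0"] Lagrange using f_p_0 norm_f_0
    by (simp add: inner_commute norm_eq_1)
  moreover have "frenet c \<alpha> f p q" ..
  ultimately have "(\<lambda>s. cross3 (p s) (q s)) = f \<and> (\<lambda>s. cross3 (q s) (f s)) = p \<and>
      (\<lambda>s. cross3 (f s) (p s)) = q"
    using q_0 by (intro frenet_unique) simp_all
  then show "cross3 (p s) (q s) = f s" "cross3 (q s) (f s) = p s" "cross3 (f s) (p s) = q s"
    by (simp_all add: fun_eq_iff)
qed

text \<open>Each of the three vectors is a cross product of the other two, hence orthogonal to
  both.\<close>

lemma orthogonal_frame [simp]: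
  "f s \<bullet> p s = 0" "f s \<bullet> q s = 0" "p s \<bullet> q s = 0"
  using dot_cross_self(2)[of "f s" "q s"] dot_cross_self(1)[of "f s" "p s"]
    dot_cross_self(2)[of "p s" "f s"]
  by (simp_all add: cross_frame)

lemma norm_f [simp]: "norm (f s) = 1" and norm_p [simp]: "norm (p s) = 1"
  and norm_q [simp]: "norm (q s) = 1"
proof -
  have "f s \<bullet> f s = f 0 \<bullet> f 0"
    by (rule DERIV_isconst_all[of "\<lambda>s. f s \<bullet> f s"], rule allI)
      (use has_field_derivative_inner[OF deriv_f deriv_f] in \<open>simp add: inner_commute\<close>)
  then show f: "norm (f s) = 1"
    using norm_f_0 by (simp add: norm_eq_1)
  have "p s \<bullet> p s = p 0 \<bullet> p 0"
    by (rule DERIV_isconst_all[of "\<lambda>s. p s \<bullet> p s"], rule allI)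
      (use has_field_derivative_inner[OF deriv_p deriv_p] in \<open>simp add: inner_commute inner_simps\<close>)
  then show p: "norm (p s) = 1"
    using norm_p_0 by (simp add: norm_eq_1)
  have "(norm (q s))\<^sup>2 = 1"
    using norm_cross[of "f s" "p s"] f p by (simp add: cross_frame)
  then show "norm (q s) = 1"
    by (simp add: abs_square_eq_1)
qed

text \<open>With even curvature and odd torsion, changing the signs of \<open>p\<close> and
  \<open>q\<close> compensates the reversal of s. Two sign changes keep the orientation.\<close>

lemma frenet_frame_reflect:
  "frenet_frame c \<alpha> (\<lambda>s. f (- s)) (\<lambda>s. - p (- s)) (\<lambda>s. - q (- s))"
proof
  show "((\<lambda>s. f (- s)) has_vector_derivative curvature c \<alpha> s *\<^sub>R - p (- s)) (at s)" for s
    using has_vector_derivative_reflect[OF deriv_f[of "- s"]] by simp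
  show "((\<lambda>s. - p (- s)) has_vector_derivative
      - (curvature c \<alpha> s *\<^sub>R f (- s)) + torsion \<alpha> s *\<^sub>R - q (- s)) (at s)" for s
    by (rule has_vector_derivative_eq_rhs[OF
          has_vector_derivative_minus[OF has_vector_derivative_reflect[OF deriv_p]]]) simp
  show "((\<lambda>s. - q (- s)) has_vector_derivative - (torsion \<alpha> s *\<^sub>R - p (- s))) (at s)" for s
    using has_vector_derivative_minus[OF has_vector_derivative_reflect[OF deriv_q[of "- s"]]]
    by simp
qed (use norm_f_0 norm_p_0 f_p_0 q_0 in auto)

text \<open>The system has scalar coefficients and so commutes with every fixed linear map.
  Orthogonality keeps lengths and angles, and determinant 1 keeps the cross product
  relation.\<close>

lemma frenet_frame_rotate:
  assumes "rotation_matrix R"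
  shows "frenet_frame c \<alpha> (\<lambda>s. R *v f s) (\<lambda>s. R *v p s) (\<lambda>s. R *v q s)"
proof -
  have R: "orthogonal_transformation ((*v) R)"
    using assms by (simp add: rotation_matrix_def orthogonal_transformation_matrix)
  have lin: "bounded_linear ((*v) R)"
    by (rule matrix_vector_mul_bounded_linear)
  show ?thesis
  proof
    show "((\<lambda>s. R *v f s) has_vector_derivative curvature c \<alpha> s *\<^sub>R (R *v p s)) (at s)" for s
      using bounded_linear.has_vector_derivative[OF lin deriv_f[of s]]
      by (simp add: matrix_vector_mult_scaleR)
    show "((\<lambda>s. R *v p s) has_vector_derivative
        - (curvature c \<alpha> s *\<^sub>R (R *v f s)) + torsion \<alpha> s *\<^sub>R (R *v q s)) (at s)" for s
      using bounded_linear.has_vector_derivative[OF lin deriv_p[of s]]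
      by (simp add: matrix_vector_mult_scaleR matrix_vector_mult_diff_distrib)
    show "((\<lambda>s. R *v q s) has_vector_derivative - (torsion \<alpha> s *\<^sub>R (R *v p s))) (at s)" for s
      using bounded_linear.has_vector_derivative[OF lin deriv_q[of s]]
      by (simp add: matrix_vector_mult_scaleR linear_neg[OF matrix_vector_mul_linear])
    show "norm (R *v f 0) = 1" "norm (R *v p 0) = 1"
      using R norm_f_0 norm_p_0 by (simp_all add: orthogonal_transformation_norm)
    show "(R *v f 0) \<bullet> (R *v p 0) = 0"
      using R f_p_0 by (simp add: orthogonal_transformation_def)
    show "R *v q 0 = cross3 (R *v f 0) (R *v p 0)"
      using cross_rotation_matrix[OF assms] q_0 by simp
  qed
qed

text \<open>Completing the square, \<open>(s / 2 - 1)\<^sup>2 \<ge> 0\<close> bounds the Gaussian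
  exponent by the linear function \<alpha> (1 - s). The resulting exponential has an elementary
  primitive.\<close>

lemma tail_estimate:
  assumes "0 \<le> c" "0 < \<alpha>" "S \<le> T"
  shows "norm (f T - f S) \<le> c / \<alpha> * exp (\<alpha> * (1 - S))"
proof (cases "S = T")
  case False
  have "norm (f T - f S) \<le> - (c / \<alpha> * exp (\<alpha> * (1 - T))) - - (c / \<alpha> * exp (\<alpha> * (1 - S)))"
  proof (rule differentiable_bound_general)
    show "S < T" using assms False by simp
    show "continuous_on {S..T} f"
      using deriv_f has_vector_derivative_continuous by (blast intro: continuous_at_imp_continuous_on)
    show "continuous_on {S..T} (\<lambda>s. - (c / \<alpha> * exp (\<alpha> * (1 - s))))"
      by (intro continuous_intros)
    show "(f has_vector_derivative curvature c \<alpha> s *\<^sub>R p s) (at s)" for s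
      by (rule deriv_f)
    show "((\<lambda>s. - (c / \<alpha> * exp (\<alpha> * (1 - s)))) has_vector_derivative c * exp (\<alpha> * (1 - s))) (at s)" for s
      unfolding has_real_derivative_iff_has_vector_derivative[symmetric]
      using assms by (auto intro!: derivative_eq_intros)
    show "norm (curvature c \<alpha> s *\<^sub>R p s) \<le> c * exp (\<alpha> * (1 - s))" for s
    proof -
      have "- \<alpha> * s\<^sup>2 / 4 = \<alpha> * (1 - s) - \<alpha> * (s / 2 - 1)\<^sup>2"
        by (simp add: power2_eq_square field_simps)
      also have "\<dots> \<le> \<alpha> * (1 - s)"
        using assms by simp
      finally show ?thesis
        using assms by (simp add: curvature_def mult_left_mono)
    qed
  qed
  also have "\<dots> \<le> c / \<alpha> * exp (\<alpha> * (1 - S))"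
    using assms by simp
  finally show ?thesis .
qed (use assms in simp)

text \<open>The rate is kept together with the limit because its dependence on c and \<alpha> is
  explicit; continuity of the limit in the parameters rests on it.\<close>

lemma limit_at_top:
  assumes "0 \<le> c" "0 < \<alpha>"
  obtains L where "(f \<longlongrightarrow> L) at_top" and "\<And>S. norm (L - f S) \<le> c / \<alpha> * exp (\<alpha> * (1 - S))"
proof -
  have lim0: "((\<lambda>S. c / \<alpha> * exp (\<alpha> * (1 - S))) \<longlongrightarrow> 0) at_top"
    using assms by real_asymp
  have lim: "((\<lambda>n. c / \<alpha> * exp (\<alpha> * (1 - real n))) \<longlonglongrightarrow> 0)"
    using assms by real_asymp
  have "Cauchy (\<lambda>n. f (real n))"
  proof (rule metric_CauchyI)
    fix e :: real assume "0 < e"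
    then obtain N where N: "\<And>n. n \<ge> N \<Longrightarrow> c / \<alpha> * exp (\<alpha> * (1 - real n)) < e"
      using order_tendstoD(2)[OF lim] by (auto simp: eventually_sequentially)
    have "norm (f (real m) - f (real n)) < e" if "n \<ge> N" "n \<le> m" for m n
      using tail_estimate[OF assms, of "real n" "real m"] N[of n] that by simp
    then have "dist (f (real m)) (f (real n)) < e" if "n \<ge> N" "m \<ge> N" for m n
      using that by (metis dist_commute dist_norm nle_le)
    then show "\<exists>M. \<forall>m\<ge>M. \<forall>n\<ge>M. dist (f (real m)) (f (real n)) < e"
      by blast
  qed
  then obtain L where L: "(\<lambda>n. f (real n)) \<longlonglongrightarrow> L"
    using Cauchy_convergent_iff convergent_def by blast
  have bound: "norm (L - f S) \<le> c / \<alpha> * exp (\<alpha> * (1 - S))" for S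
  proof (rule tendsto_upperbound)
    show "((\<lambda>n. norm (f (real n) - f S)) \<longlonglongrightarrow> norm (L - f S))"
      by (intro tendsto_intros L)
    show "\<forall>\<^sub>F n in sequentially. norm (f (real n) - f S) \<le> c / \<alpha> * exp (\<alpha> * (1 - S))"
      using eventually_ge_at_top[of "nat \<lceil>S\<rceil>"]
      by eventually_elim (rule tail_estimate[OF assms], linarith)
  qed simp
  have "((\<lambda>S. f S - L) \<longlongrightarrow> 0) at_top"
    by (rule Lim_null_comparison[OF _ lim0]) (use bound in \<open>simp add: norm_minus_commute\<close>)
  then show ?thesis
    using that bound by (simp add: Lim_null[symmetric])
qed

end

text \<open>Discharges the description operator in \<open>profile\<close> once and for all, by
  existence and uniqueness for the linear system.\<close>

lemma profile_frame:
  obtains p q where "frenet_frame c \<alpha> (profile c \<alpha>) p q"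
    and "profile c \<alpha> 0 = vector [1, 0, 0]" and "p 0 = vector [0, 1, 0]" and "q 0 = vector [0, 0, 1]"
proof -
  obtain f p q where *: "frenet c \<alpha> f p q" "f 0 = vector [1, 0, 0]" "p 0 = vector [0, 1, 0]"
    "q 0 = vector [0, 0, 1]"
    by (rule frenet_exists)
  have "(THE F. serret_frenet c \<alpha> F) = (f, p, q)"
  proof (rule the_equality)
    fix F assume F: "serret_frenet c \<alpha> F"
    obtain f' p' q' where "F = (f', p', q')"
      by (cases F)
    then show "F = (f, p, q)"
      using F * frenet_unique[of c \<alpha> f' p' q' f p q] by (simp add: serret_frenet_iff)
  qed (use * in \<open>simp add: serret_frenet_iff\<close>)
  then have "profile c \<alpha> = f"
    by (simp add: profile_def)
  moreover have "frenet_frame c \<alpha> f p q"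
    unfolding frenet_frame_def frenet_frame_axioms_def *
    using *(1) by (simp add: norm_eq_1 inner_vec_def sum_3 vec_eq_iff forall_3 cross_components)
  ultimately show ?thesis
    using that * by auto
qed

text \<open>Identifies the profile from a guessed frame; this serves for the half-turn symmetry and
  for the explicit curve at \<alpha> = 1.\<close>

lemma profile_eqI:
  assumes "frenet c \<alpha> f p q"
    and "f 0 = vector [1, 0, 0]" and "p 0 = vector [0, 1, 0]" and "q 0 = vector [0, 0, 1]"
  shows "profile c \<alpha> = f"
proof -
  obtain p' q' where *: "frenet_frame c \<alpha> (profile c \<alpha>) p' q'"
    "profile c \<alpha> 0 = vector [1, 0, 0]" "p' 0 = vector [0, 1, 0]" "q' 0 = vector [0, 0, 1]"
    by (rule profile_frame)
  then show ?thesis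
    using frenet_unique[OF frenet_frame.axioms(1)[OF *(1)] assms(1)] assms(2-) by simp
qed

section \<open>Smoothness and the LLG equation\<close>

lemma times_differentiable_on_cong:
  assumes "open S" and "\<And>x. x \<in> S \<Longrightarrow> f x = g x" and "times_differentiable_on n f S"
  shows "times_differentiable_on n g S"
  using assms(2,3)
proof (induction n arbitrary: f g)
  case 0
  then show ?case
    using continuous_on_cong[of S S f g] by simp
next
  case (Suc n)
  have deriv: "(g has_derivative f') (at x)" if "(f has_derivative f') (at x)" "x \<in> S" for f' x
    using has_derivative_transform_within_open[OF that(1) assms(1) that(2)] Suc.prems(1) by simp
  have diff: "f differentiable (at x)" if "x \<in> S" for x
    using Suc.prems(2) that by simp
  have eq: "frechet_derivative f (at x) v = frechet_derivative g (at x) v" if "x \<in> S" for x v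
    using frechet_derivative_at[OF deriv] diff frechet_derivative_works that by metis
  have "times_differentiable_on n (\<lambda>x. frechet_derivative g (at x) v) S" for v
    by (rule Suc.IH[OF eq]) (use Suc.prems(2) in simp_all)
  moreover have "g differentiable (at x)" if "x \<in> S" for x
    using diff[OF that] deriv[OF _ that] unfolding differentiable_def by blast
  ultimately show ?case
    by simp
qed

text \<open>Replaces the chosen \<open>frechet_derivative\<close> by any explicit derivative, so
  that the inductions below can work with the usual differentiation rules.\<close>

lemma times_differentiable_on_SucI:
  assumes "open S" and "\<And>x. x \<in> S \<Longrightarrow> (f has_derivative F x) (at x)"
    and "\<And>v. times_differentiable_on n (\<lambda>x. F x v) S"
  shows "times_differentiable_on (Suc n) f S"
proof -
  have "times_differentiable_on n (\<lambda>x. frechet_derivative f (at x) v) S" for v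
    by (rule times_differentiable_on_cong[OF assms(1) _ assms(3)[of v]])
      (use assms(2) frechet_derivative_at in metis)
  then show ?thesis
    using assms(2) differentiable_def by (simp add: Ball_def) blast
qed

lemma times_differentiable_on_has_derivative:
  assumes "times_differentiable_on (Suc n) f S" and "x \<in> S"
  shows "(f has_derivative frechet_derivative f (at x)) (at x)"
  using assms frechet_derivative_works by auto

text \<open>Needed for the product and chain rules, where undifferentiated factors appear beside the
  derivatives and must be available at the lower order.\<close>

lemma times_differentiable_on_Suc_imp:
  "times_differentiable_on (Suc n) f S \<Longrightarrow> times_differentiable_on n f S"
proof (induction n arbitrary: f)
  case 0
  then show ?case
    by (auto intro!: continuous_at_imp_continuous_on differentiable_imp_continuous_within)
qed simp

lemma times_differentiable_on_const: "open S \<Longrightarrow> times_differentiable_on n (\<lambda>x. a) S"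
  by (induction n arbitrary: a) (auto intro!: times_differentiable_on_SucI has_derivative_const)

lemma times_differentiable_on_linear:
  assumes "open S" and "bounded_linear f"
  shows "times_differentiable_on n f S"
proof (cases n)
  case 0
  then show ?thesis
    using assms by (simp add: linear_continuous_on)
next
  case (Suc k)
  show ?thesis
    unfolding Suc
    by (rule times_differentiable_on_SucI[OF assms(1), where F = "\<lambda>x. f"])
      (auto intro!: bounded_linear_imp_has_derivative times_differentiable_on_const assms)
qed

lemma times_differentiable_on_add:
  assumes "open S" and "times_differentiable_on n f S" and "times_differentiable_on n g S"
  shows "times_differentiable_on n (\<lambda>x. f x + g x) S"
  using assms(2,3)
proof (induction n arbitrary: f g)
  case (Suc n)
  show ?case
  proof (rule times_differentiable_on_SucI[OF assms(1)])
    show "((\<lambda>x. f x + g x) has_derivative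
        (\<lambda>v. frechet_derivative f (at x) v + frechet_derivative g (at x) v)) (at x)" if "x \<in> S" for x
      using that Suc.prems by (intro has_derivative_add times_differentiable_on_has_derivative)
  qed (use Suc in auto)
qed (auto intro: continuous_on_add)

lemma times_differentiable_on_scaleR:
  assumes "open S" and "times_differentiable_on n f S" and "times_differentiable_on n g S"
  shows "times_differentiable_on n (\<lambda>x. f x *\<^sub>R g x) S"
  using assms(2,3)
proof (induction n arbitrary: f g)
  case (Suc n)
  note Suc' = Suc.prems[THEN times_differentiable_on_Suc_imp]
  show ?case
  proof (rule times_differentiable_on_SucI[OF assms(1)])
    show "((\<lambda>x. f x *\<^sub>R g x) has_derivative
        (\<lambda>v. f x *\<^sub>R frechet_derivative g (at x) v + frechet_derivative f (at x) v *\<^sub>R g x)) (at x)"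
      if "x \<in> S" for x
      using that Suc.prems by (intro has_derivative_scaleR times_differentiable_on_has_derivative)
    show "times_differentiable_on n
        (\<lambda>x. f x *\<^sub>R frechet_derivative g (at x) v + frechet_derivative f (at x) v *\<^sub>R g x) S" for v
      using Suc.prems Suc' by (intro times_differentiable_on_add[OF assms(1)] Suc.IH) auto
  qed
qed (auto intro: continuous_on_scaleR)

text \<open>With a real-valued inner function the chain rule yields a scalar multiple of a vector,
  so the closure under \<open>*\<^sub>R\<close> completes the induction.\<close>

lemma times_differentiable_on_compose:
  fixes h :: "'a::euclidean_space \<Rightarrow> real" and g :: "real \<Rightarrow> 'b::euclidean_space"
  assumes "open S" and "h ` S \<subseteq> T"
    and "times_differentiable_on n g T" and "times_differentiable_on n h S"
  shows "times_differentiable_on n (\<lambda>x. g (h x)) S"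
  using assms(3,4)
proof (induction n arbitrary: g)
  case 0
  then show ?case
    using continuous_on_compose2[of T g S h] assms(2) by simp
next
  case (Suc n)
  show ?case
  proof (rule times_differentiable_on_SucI[OF assms(1)])
    show "((\<lambda>x. g (h x)) has_derivative
        (\<lambda>v. frechet_derivative h (at x) v *\<^sub>R frechet_derivative g (at (h x)) 1)) (at x)"
      if "x \<in> S" for x
    proof -
      have g: "(g has_derivative frechet_derivative g (at (h x))) (at (h x))"
        using that assms(2) by (intro times_differentiable_on_has_derivative[OF Suc.prems(1)]) auto
      have "frechet_derivative g (at (h x)) r = r *\<^sub>R frechet_derivative g (at (h x)) 1" for r
        using linear_cmul[OF has_derivative_linear[OF g], of r 1] by simp
      then show ?thesis
        by (intro has_derivative_eq_rhs[OF has_derivative_compose[OF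
              times_differentiable_on_has_derivative[OF Suc.prems(2) that] g]]) (rule ext)
    qed
    show "times_differentiable_on n
        (\<lambda>x. frechet_derivative h (at x) v *\<^sub>R frechet_derivative g (at (h x)) 1) S" for v
      using Suc.prems Suc.prems(2)[THEN times_differentiable_on_Suc_imp]
      by (intro times_differentiable_on_scaleR[OF assms(1)] Suc.IH) auto
  qed
qed

lemma times_differentiable_on_Suc_vectorI:
  assumes "open S" and "\<And>x. x \<in> S \<Longrightarrow> (f has_vector_derivative g x) (at x)"
    and "times_differentiable_on n g S"
  shows "times_differentiable_on (Suc n) f S"
  using assms
  by (intro times_differentiable_on_SucI[OF assms(1), of f "\<lambda>x v. v *\<^sub>R g x"])
    (auto simp: has_vector_derivative_def
      intro!: times_differentiable_on_scaleR times_differentiable_on_const)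

text \<open>The exponent is generalized because every derivative lowers it by one. The case -1/2
  provides the factor 1 / sqrt t.\<close>

lemma times_differentiable_on_powr:
  "times_differentiable_on n (\<lambda>t::real. t powr a) {0<..}"
proof (induction n arbitrary: a)
  case 0
  show ?case by (auto intro!: continuous_intros)
next
  case (Suc n)
  have "times_differentiable_on n (\<lambda>t::real. a * t powr (a - 1)) {0<..}"
    using times_differentiable_on_scaleR[OF _ times_differentiable_on_const Suc.IH, of "a" "a - 1"]
    by simp
  then show ?case
    by (intro times_differentiable_on_Suc_vectorI[where g = "\<lambda>t. a * t powr (a - 1)"])
      (auto simp: has_real_derivative_iff_has_vector_derivative[symmetric]
        intro!: has_real_derivative_powr)
qed

lemma times_differentiable_on_torsion: "times_differentiable_on n (torsion \<alpha>) UNIV"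
proof -
  have "torsion \<alpha> = (*) (sqrt (1 - \<alpha>\<^sup>2) / 2)"
    by (auto simp: torsion_def)
  then show ?thesis
    by (simp add: times_differentiable_on_linear bounded_linear_mult_right)
qed

lemma times_differentiable_on_curvature: "times_differentiable_on n (curvature c \<alpha>) UNIV"
proof (induction n)
  case 0
  show ?case unfolding curvature_def [abs_def] by (auto intro!: continuous_intros)
next
  case (Suc n)
  have "times_differentiable_on n (\<lambda>s::real. - (\<alpha> / 2) * s) UNIV"
    by (intro times_differentiable_on_linear bounded_linear_mult_right) auto
  then have "times_differentiable_on n (\<lambda>s. - (\<alpha> * s / 2) * curvature c \<alpha> s) UNIV"
    using times_differentiable_on_scaleR[OF _ _ Suc.IH, of "\<lambda>s. - (\<alpha> / 2) * s"] by simp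
  then show ?case
    by (rule times_differentiable_on_Suc_vectorI[OF open_UNIV
          has_field_derivative_curvature[unfolded has_real_derivative_iff_has_vector_derivative]])
qed

section \<open>Parabolic lifts of functions of one variable\<close>

definition parabolic :: "(real \<Rightarrow> 'a) \<Rightarrow> real \<times> real \<Rightarrow> 'a" where
  "parabolic f = (\<lambda>(x, t). f (x / sqrt t))"

lemma parabolic_Pair [simp]: "parabolic f (x, t) = f (x / sqrt t)"
  by (simp add: parabolic_def)

lemma m_ss_eq_parabolic: "m_ss c \<alpha> = parabolic (profile c \<alpha>)"
  by (simp add: m_ss_def parabolic_def)

lemma self_similar_parabolic: "self_similar (parabolic f)"
  by (auto simp: self_similar_def real_sqrt_mult)

lemma open_half_plane: "open half_plane"
  by (intro open_Times) auto

lemma smooth_on_parabolic: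
  fixes f :: "real \<Rightarrow> 'a::euclidean_space"
  assumes "\<And>n. times_differentiable_on n f UNIV"
  shows "smooth_on (parabolic f) half_plane"
proof -
  have "times_differentiable_on n (parabolic f) half_plane" for n
  proof -
    have "times_differentiable_on n (\<lambda>z. snd z powr (- 1 / 2)) (half_plane :: (real \<times> real) set)"
      by (rule times_differentiable_on_compose[OF open_half_plane _ times_differentiable_on_powr
            times_differentiable_on_linear[OF open_half_plane bounded_linear_snd]]) auto
    then have "times_differentiable_on n (\<lambda>z. fst z *\<^sub>R snd z powr (- 1 / 2)) (half_plane :: (real \<times> real) set)"
      by (intro times_differentiable_on_scaleR open_half_plane
          times_differentiable_on_linear[OF open_half_plane bounded_linear_fst])
    then have "times_differentiable_on n (\<lambda>z. f (fst z *\<^sub>R snd z powr (- 1 / 2))) half_plane"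
      by (intro times_differentiable_on_compose[OF open_half_plane subset_UNIV assms])
    then show ?thesis
      by (rule times_differentiable_on_cong[OF open_half_plane, rotated])
        (auto simp: powr_minus powr_half_sqrt field_simps)
  qed
  then show ?thesis
    by (simp add: smooth_on_def)
qed

lemma (in frenet) continuous_frenet:
  "continuous_on S f" "continuous_on S p" "continuous_on S q"
  using has_vector_derivative_continuous[OF deriv_f] has_vector_derivative_continuous[OF deriv_p]
    has_vector_derivative_continuous[OF deriv_q]
  by (simp_all add: continuous_at_imp_continuous_on)

text \<open>Bootstrapping: the derivatives of the frame are smooth coefficients times the frame
  itself, so each order yields the next for all three vectors at once.\<close>

lemma (in frenet) times_differentiable_on_frenet:
  "times_differentiable_on n f UNIV \<and> times_differentiable_on n p UNIV \<and>
    times_differentiable_on n q UNIV"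
proof (induction n)
  case 0
  show ?case
    by (simp add: continuous_frenet)
next
  case (Suc n)
  note scale = times_differentiable_on_scaleR[OF open_UNIV]
  note w = scale[OF times_differentiable_on_curvature[of n c \<alpha>]]
    and b = scale[OF times_differentiable_on_torsion[of n \<alpha>]]
  have neg: "times_differentiable_on n (\<lambda>s. - g s) UNIV"
    if "times_differentiable_on n g UNIV" for g :: "real \<Rightarrow> real^3"
    using scale[OF times_differentiable_on_const[OF open_UNIV] that, of "-1"] by simp
  have "times_differentiable_on (Suc n) f UNIV"
    by (rule times_differentiable_on_Suc_vectorI[OF open_UNIV deriv_f]) (use Suc w in blast)
  moreover have "times_differentiable_on (Suc n) p UNIV"
    by (rule times_differentiable_on_Suc_vectorI[OF open_UNIV deriv_p],
        rule times_differentiable_on_add[OF open_UNIV neg[OF w] b]) (use Suc in auto)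
  moreover have "times_differentiable_on (Suc n) q UNIV"
    by (rule times_differentiable_on_Suc_vectorI[OF open_UNIV deriv_q], rule neg[OF b])
      (use Suc in auto)
  ultimately show ?case
    by blast
qed

lemma has_vector_derivative_parabolic_x:
  assumes "(f has_vector_derivative f') (at (x / sqrt t))"
  shows "((\<lambda>y. parabolic f (y, t)) has_vector_derivative (1 / sqrt t) *\<^sub>R f') (at x)"
proof -
  have "((\<lambda>y. y / sqrt t) has_vector_derivative 1 / sqrt t) (at x)"
    by (rule bounded_linear.has_vector_derivative[OF bounded_linear_divide has_vector_derivative_id])
  from vector_diff_chain_at[OF this assms] show ?thesis
    by (simp add: o_def)
qed

lemma has_vector_derivative_parabolic_t:
  assumes "(f has_vector_derivative f') (at (x / sqrt t))" and "0 < t"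
  shows "((\<lambda>s. parabolic f (x, s)) has_vector_derivative - (x / sqrt t / (2 * t)) *\<^sub>R f') (at t)"
proof -
  have "((\<lambda>s. x / sqrt s) has_vector_derivative - (x / sqrt t / (2 * t))) (at t)"
    unfolding has_real_derivative_iff_has_vector_derivative[symmetric]
    using assms(2) by (auto intro!: derivative_eq_intros simp: field_simps)
  from vector_diff_chain_at[OF this assms(1)] show ?thesis
    by (simp add: o_def)
qed

context frenet_frame
begin

lemma smooth_on_parabolic_frame: "smooth_on (parabolic f) half_plane"
  using times_differentiable_on_frenet by (intro smooth_on_parabolic) blast

lemma dx_parabolic:
  "dx (parabolic f) (x, t) = (curvature c \<alpha> (x / sqrt t) / sqrt t) *\<^sub>R p (x / sqrt t)"
  unfolding dx_def prod.case
  by (rule vector_derivative_at[OF has_vector_derivative_eq_rhs[OF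
          has_vector_derivative_parabolic_x[OF deriv_f]]]) simp

lemma dt_parabolic:
  assumes "0 < t"
  shows "dt (parabolic f) (x, t) =
    - (x / sqrt t / (2 * t)) *\<^sub>R curvature c \<alpha> (x / sqrt t) *\<^sub>R p (x / sqrt t)"
  unfolding dt_def prod.case
  by (rule vector_derivative_at[OF has_vector_derivative_parabolic_t[OF deriv_f assms]])

lemma dx_dx_parabolic:
  fixes x t :: real
  defines "s \<equiv> x / sqrt t"
  assumes "0 < t"
  shows "dx (dx (parabolic f)) (x, t) = (curvature c \<alpha> s / t) *\<^sub>R
    (- (\<alpha> * s / 2) *\<^sub>R p s - curvature c \<alpha> s *\<^sub>R f s + torsion \<alpha> s *\<^sub>R q s)"
proof -
  \<comment> \<open>At the fixed time \<open>t\<close> the first derivative is itself a lift, with 1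
    / sqrt t absorbed into \<open>?g\<close>, so the same chain rule serves a second time.\<close>
  let ?g = "\<lambda>s. (1 / sqrt t) *\<^sub>R curvature c \<alpha> s *\<^sub>R p s"
  have "(?g has_vector_derivative (1 / sqrt t) *\<^sub>R
      (curvature c \<alpha> s *\<^sub>R (- (curvature c \<alpha> s *\<^sub>R f s) + torsion \<alpha> s *\<^sub>R q s) +
        (- (\<alpha> * s / 2) * curvature c \<alpha> s) *\<^sub>R p s)) (at s)"
    by (rule bounded_linear.has_vector_derivative[OF bounded_linear_scaleR_right
          has_vector_derivative_scaleR[OF has_field_derivative_curvature deriv_p]])
  then have "((\<lambda>y. parabolic ?g (y, t)) has_vector_derivative (1 / sqrt t) *\<^sub>R (1 / sqrt t) *\<^sub>R
      (curvature c \<alpha> s *\<^sub>R (- (curvature c \<alpha> s *\<^sub>R f s) + torsion \<alpha> s *\<^sub>R q s) +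
        (- (\<alpha> * s / 2) * curvature c \<alpha> s) *\<^sub>R p s)) (at x)"
    unfolding s_def by (rule has_vector_derivative_parabolic_x)
  moreover have "(\<lambda>y. parabolic ?g (y, t)) = (\<lambda>y. dx (parabolic f) (y, t))"
    by (simp add: dx_parabolic)
  ultimately have "dx (dx (parabolic f)) (x, t) = (1 / sqrt t) *\<^sub>R (1 / sqrt t) *\<^sub>R
      (curvature c \<alpha> s *\<^sub>R (- (curvature c \<alpha> s *\<^sub>R f s) + torsion \<alpha> s *\<^sub>R q s) +
        (- (\<alpha> * s / 2) * curvature c \<alpha> s) *\<^sub>R p s)"
    unfolding dx_def[of "dx (parabolic f)"] by (simp add: vector_derivative_at)
  also have "\<dots> = (curvature c \<alpha> s / t) *\<^sub>R
    (- (\<alpha> * s / 2) *\<^sub>R p s - curvature c \<alpha> s *\<^sub>R f s + torsion \<alpha> s *\<^sub>R q s)"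
    using assms(2) by (simp add: vec_eq_iff) (simp add: field_simps)
  finally show ?thesis .
qed

text \<open>The map v to f x v kills \<open>f\<close> and turns the plane of \<open>p\<close> and
  \<open>q\<close> by a right angle, taking \<open>p\<close> to \<open>q\<close> and
  \<open>q\<close> to \<open>- p\<close>. In the equation the \<open>q\<close> terms cancel, and
  \<alpha>^2 + \<beta>^2 = 1 leaves exactly the multiple of \<open>p\<close> produced by the time
  derivative.\<close>

lemma LLG_parabolic:
  assumes "\<bar>\<alpha>\<bar> \<le> 1"
  shows "LLG \<alpha> (parabolic f)"
  unfolding LLG_def
proof
  fix z :: "real \<times> real" assume "z \<in> half_plane"
  then obtain x t where z: "z = (x, t)" and t: "0 < t"
    by auto
  define s where "s = x / sqrt t"
  define w where "w = curvature c \<alpha> s"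
  define \<beta> where "\<beta> = sqrt (1 - \<alpha>\<^sup>2)"
  have \<beta>: "\<beta> * \<beta> = 1 - \<alpha> * \<alpha>"
    using assms by (simp add: \<beta>_def abs_square_le_1 power2_eq_square[symmetric])
  have fq: "cross3 (f s) (q s) = - p s"
    using cross_skew[of "f s" "q s"] by (simp add: cross_frame)
  define W \<sigma> where "W = w / t" and "\<sigma> = s / 2"
  have 1: "cross3 (f s) (dx (dx (parabolic f)) (x, t)) = W *\<^sub>R (- (\<alpha> * \<sigma>) *\<^sub>R q s - (\<beta> * \<sigma>) *\<^sub>R p s)"
    unfolding dx_dx_parabolic[OF t] s_def[symmetric] w_def[symmetric] W_def \<sigma>_def
    by (simp add: cross_add_right Cross3.right_diff_distrib cross_mult_right cross_frame fq
        torsion_def \<beta>_def)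
  have 2: "cross3 (f s) (cross3 (f s) (dx (dx (parabolic f)) (x, t))) =
      W *\<^sub>R ((\<alpha> * \<sigma>) *\<^sub>R p s - (\<beta> * \<sigma>) *\<^sub>R q s)"
    unfolding 1
    by (simp add: cross_add_right Cross3.right_diff_distrib cross_mult_right cross_frame fq)
  have "\<beta> *\<^sub>R cross3 (f s) (dx (dx (parabolic f)) (x, t)) -
      \<alpha> *\<^sub>R cross3 (f s) (cross3 (f s) (dx (dx (parabolic f)) (x, t))) =
      (W * (- \<sigma> * (\<beta> * \<beta> + \<alpha> * \<alpha>))) *\<^sub>R p s"
    unfolding 2 unfolding 1 by (simp add: vec_eq_iff algebra_simps)
  also have "\<dots> = dt (parabolic f) (x, t)"
    unfolding dt_parabolic[OF t] \<beta> s_def[symmetric] w_def[symmetric] W_def \<sigma>_def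
    by (simp add: mult.commute)
  finally show "dt (parabolic f) z =
      sqrt (1 - \<alpha>\<^sup>2) *\<^sub>R cross3 (parabolic f z) (dx (dx (parabolic f)) z) -
      \<alpha> *\<^sub>R cross3 (parabolic f z) (cross3 (parabolic f z) (dx (dx (parabolic f)) z))"
    by (simp add: \<beta>_def s_def z)
qed

end

section \<open>Weak derivatives and initial data\<close>

lemma Linf_norm_le:
  assumes "continuous_on UNIV g" and "\<And>x. norm (g x) \<le> C"
  shows "Linf_norm g \<le> ennreal C"
  unfolding Linf_norm_def
proof (rule esssup_I)
  have "(\<lambda>x. ennreal (norm (g x))) \<in> borel_measurable borel"
    by (intro borel_measurable_continuous_onI continuous_on_ennreal continuous_on_norm assms)
  then show "(\<lambda>x. ennreal (norm (g x))) \<in> borel_measurable lebesgue"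
    by (simp add: measurable_completion)
qed (use assms(2) in \<open>auto intro!: AE_I2 ennreal_leI\<close>)

text \<open>For continuous \<open>g\<close> the set where the norm exceeds the essential supremum is
  open and null, hence empty.\<close>

lemma Linf_norm_attained:
  assumes "continuous_on UNIV g" and "\<And>x. norm (g x) \<le> norm (g a)"
  shows "Linf_norm g = ennreal (norm (g a))"
proof (rule antisym)
  let ?h = "\<lambda>x. ennreal (norm (g x))"
  show "ennreal (norm (g a)) \<le> Linf_norm g"
  proof (rule ccontr)
    assume "\<not> ennreal (norm (g a)) \<le> Linf_norm g"
    then have a: "a \<in> {x. Linf_norm g < ?h x}"
      by simp
    have "open {x. Linf_norm g < ?h x}"
      by (intro open_Collect_less continuous_on_const continuous_on_ennreal continuous_on_norm assms)
    moreover have "AE x in lebesgue. ?h x \<le> Linf_norm g"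
      unfolding Linf_norm_def by (rule esssup_AE)
    then have "AE x in lebesgue. x \<notin> {x. Linf_norm g < ?h x}"
      by (simp add: not_less)
    then have "negligible {x. Linf_norm g < ?h x}"
      using \<open>open {x. Linf_norm g < ?h x}\<close> unfolding negligible_iff_null_sets
      by (subst AE_iff_null_sets) (auto intro: borel_open)
    ultimately show False
      using a open_not_negligible by blast
  qed
qed (use Linf_norm_le[OF assms] in simp)

lemma locally_integrable_continuous:
  assumes "continuous_on half_plane v"
  shows "locally_integrable v"
  unfolding locally_integrable_def
proof (intro allI impI)
  fix K :: "(real \<times> real) set" assume K: "compact K \<and> K \<subseteq> half_plane"
  then have "integrable lborel (\<lambda>z. indicator K z *\<^sub>R v z)"
    by (intro borel_integrable_compact continuous_on_subset[OF assms]) auto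
  then show "v absolutely_integrable_on K"
    by (simp add: set_integrable_def integrable_completion borel_measurable_integrable)
qed

lemma test_function_differentiable:
  assumes "test_function U \<phi>"
  shows "(\<phi> has_derivative frechet_derivative \<phi> (at z)) (at z)"
    and "continuous_on S (\<lambda>z. frechet_derivative \<phi> (at z) v)"
    and "continuous_on S \<phi>"
proof -
  have 1: "times_differentiable_on (Suc 0) \<phi> UNIV" and 0: "times_differentiable_on 0 \<phi> UNIV"
    using assms unfolding test_function_def smooth_on_def by blast+
  show "(\<phi> has_derivative frechet_derivative \<phi> (at z)) (at z)"
    by (rule times_differentiable_on_has_derivative[OF 1 UNIV_I])
  show "continuous_on S (\<lambda>z. frechet_derivative \<phi> (at z) v)"
    using 1 by (auto intro: continuous_on_subset[OF _ subset_UNIV])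
  show "continuous_on S \<phi>"
    using 0 continuous_on_subset[OF _ subset_UNIV] by simp
qed

text \<open>The values of \<open>v\<close> outside the half plane are arbitrary, but the test
  function vanishes there. Continuity is glued from the two open sets \<open>U\<close> and
  \<open>- K\<close>.\<close>

lemma continuous_on_scaleR_support:
  fixes g :: "'a::topological_space \<Rightarrow> real" and v :: "'a \<Rightarrow> 'b::real_normed_vector"
  assumes "continuous_on UNIV g" and "continuous_on U v" and "open U" and "closed K" and "K \<subseteq> U"
    and "\<And>z. z \<notin> K \<Longrightarrow> g z = 0"
  shows "continuous_on UNIV (\<lambda>z. g z *\<^sub>R v z)"
proof -
  have "continuous_on (- K) (\<lambda>z. g z *\<^sub>R v z) \<longleftrightarrow> continuous_on (- K) (\<lambda>z. 0 :: 'b)"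
    using assms(6) by (intro continuous_on_cong) auto
  then have "continuous_on (- K) (\<lambda>z. g z *\<^sub>R v z)"
    by simp
  moreover have "continuous_on U (\<lambda>z. g z *\<^sub>R v z)"
    using assms(1,2) by (intro continuous_on_scaleR) (auto intro: continuous_on_subset)
  ultimately have "continuous_on (U \<union> - K) (\<lambda>z. g z *\<^sub>R v z)"
    using assms(3,4) by (intro continuous_on_open_Un) auto
  moreover have "U \<union> - K = UNIV"
    using assms(5) by auto
  ultimately show ?thesis by simp
qed

lemma integrable_compact_support:
  fixes g :: "'a::euclidean_space \<Rightarrow> 'b::{banach, second_countable_topology}"
  assumes "continuous_on UNIV g" and "compact K" and "\<And>z. z \<notin> K \<Longrightarrow> g z = 0"
  shows "integrable lborel g"
proof -
  have "integrable lborel (\<lambda>x. indicator K x *\<^sub>R g x)"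
    using assms by (intro borel_integrable_compact) (auto intro: continuous_on_subset)
  moreover have "indicator K x *\<^sub>R g x = g x" for x
    using assms(3)[of x] by (auto simp: indicator_def)
  ultimately show ?thesis by (simp del: scaleR_eq_0_iff)
qed

lemma test_function_integrable:
  assumes "test_function U \<phi>"
  shows "integrable lborel \<phi>"
proof (rule integrable_compact_support)
  show "compact (closure {x. \<phi> x \<noteq> 0})"
    using assms by (simp add: test_function_def)
  show "\<phi> z = 0" if "z \<notin> closure {x. \<phi> x \<noteq> 0}" for z
    using that closure_subset[of "{x. \<phi> x \<noteq> 0}"] by auto
qed (rule test_function_differentiable(3)[OF assms])

text \<open>Fubini reduces the claim to \<open>\<integral> \<partial>\<^sub>x(\<phi> v) dx = 0\<close> on every horizontal line.\<close>

lemma weak_dx_classical: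
  assumes v: "continuous_on half_plane v" and w: "continuous_on half_plane w"
    and deriv: "\<And>x t. 0 < t \<Longrightarrow> ((\<lambda>y. v (y, t)) has_vector_derivative w (x, t)) (at x)"
  shows "weak_dx v w"
  unfolding weak_dx_def
proof (intro allI impI)
  fix \<phi> :: "real \<times> real \<Rightarrow> real" assume \<phi>: "test_function half_plane \<phi>"
  define K where "K = closure {z. \<phi> z \<noteq> 0}"
  have K: "compact K" "closed K" "K \<subseteq> half_plane"
    using \<phi> by (simp_all add: K_def test_function_def)
  have \<phi>0: "\<phi> z = 0" if "z \<notin> K" for z
    using that closure_subset[of "{z. \<phi> z \<noteq> 0}"] by (auto simp: K_def)
  have dx\<phi>: "((\<lambda>y. \<phi> (y, t)) has_vector_derivative dx \<phi> (x, t)) (at x)"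
    and dx_eq: "dx \<phi> (x, t) = frechet_derivative \<phi> (at (x, t)) (1, 0)" for x t
  proof -
    have "((\<lambda>y. (y, t)) has_vector_derivative (1, 0)) (at x)"
      by (auto intro!: has_vector_derivative_Pair has_vector_derivative_id has_vector_derivative_const)
    from vector_derivative_diff_chain_within[OF this, of \<phi> "frechet_derivative \<phi> (at (x, t))"]
    have *: "((\<lambda>y. \<phi> (y, t)) has_vector_derivative frechet_derivative \<phi> (at (x, t)) (1, 0)) (at x)"
      using test_function_differentiable(1)[OF \<phi>, of "(x, t)"]
      by (simp add: o_def has_derivative_at_withinI)
    then show "dx \<phi> (x, t) = frechet_derivative \<phi> (at (x, t)) (1, 0)"
      by (simp add: dx_def vector_derivative_at)
    with * show "((\<lambda>y. \<phi> (y, t)) has_vector_derivative dx \<phi> (x, t)) (at x)"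
      by simp
  qed
  have dx0: "dx \<phi> z = 0" if "z \<notin> K" for z
  proof -
    have "(\<phi> has_derivative (\<lambda>h. 0)) (at z)"
      by (rule has_derivative_transform_within_open[OF has_derivative_const, of "- K"])
        (use that K \<phi>0 in auto)
    then show ?thesis
      using dx_eq[of "fst z" "snd z"] frechet_derivative_at[of \<phi> "\<lambda>h. 0" z, symmetric] by simp
  qed
  have dx_cont: "continuous_on UNIV (dx \<phi>)"
    using test_function_differentiable(2)[OF \<phi>, of UNIV "(1, 0)"] dx_eq
    by (metis (no_types, lifting) continuous_on_cong surj_pair)
  define G1 G2 G where "G1 z = dx \<phi> z *\<^sub>R v z" and "G2 z = \<phi> z *\<^sub>R w z" and "G z = G2 z + G1 z" for z
  have G12_cont: "continuous_on UNIV G1" "continuous_on UNIV G2"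
    unfolding G1_def G2_def
    using continuous_on_scaleR_support[OF dx_cont v open_half_plane K(2,3) dx0]
      continuous_on_scaleR_support[OF test_function_differentiable(3)[OF \<phi>] w open_half_plane K(2,3) \<phi>0]
    by auto
  have G_cont: "continuous_on UNIV G"
    unfolding G_def by (intro continuous_intros G12_cont)
  have G0: "G1 z = 0" "G2 z = 0" "G z = 0" if "z \<notin> K" for z
    using that dx0 \<phi>0 by (auto simp: G1_def G2_def G_def)
  have int: "integrable lborel G1" "integrable lborel G2" "integrable lborel G"
    using integrable_compact_support[OF _ K(1)] G12_cont G_cont G0 by blast+
  obtain B where B: "\<And>z. z \<in> K \<Longrightarrow> norm z \<le> B" "0 < B"
    using compact_imp_bounded[OF K(1)] unfolding bounded_pos by blast
  have line: "(LINT x|lborel. G (x, t)) = 0" for t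
  proof -
    \<comment> \<open>Beyond this bound the line has left the support, so both boundary terms of the
      fundamental theorem vanish.\<close>
    define b where "b = B + 1"
    have outside: "(x, t) \<notin> K" if "b \<le> \<bar>x\<bar>" for x
    proof
      assume "(x, t) \<in> K"
      then have "norm (x, t) \<le> B" by (rule B)
      moreover have "norm x \<le> norm (x, t)" by (rule norm_fst_le)
      ultimately show False using that by (simp add: b_def)
    qed
    have "((\<lambda>y. \<phi> (y, t) *\<^sub>R v (y, t)) has_vector_derivative G (x, t)) (at x)" for x
    proof (cases "0 < t")
      case True
      show ?thesis
        unfolding G_def G1_def G2_def
        using has_vector_derivative_scaleR[of "\<lambda>y. \<phi> (y, t)" "dx \<phi> (x, t)", OF _ deriv[OF True]] dx\<phi>
        by (simp add: has_real_derivative_iff_has_vector_derivative)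
    next
      case False
      then have "(y, t) \<notin> K" for y using K(3) by auto
      then show ?thesis by (simp add: \<phi>0 G0)
    qed
    then have "integral\<^sup>L lborel (\<lambda>x. indicator {- b..b} x *\<^sub>R G (x, t)) =
        \<phi> (b, t) *\<^sub>R v (b, t) - \<phi> (- b, t) *\<^sub>R v (- b, t)"
      using B(2)
      by (intro integral_FTC_atLeastAtMost)
        (auto simp: b_def intro: has_vector_derivative_at_within
          intro!: continuous_on_compose2[OF G_cont] continuous_intros)
    also have "\<dots> = 0"
      using \<phi>0[OF outside] B(2) by (simp add: b_def)
    also have "(\<lambda>x. indicator {- b..b} x *\<^sub>R G (x, t)) = (\<lambda>x. G (x, t))"
      by (rule ext) (use G0(3)[OF outside] in \<open>force simp: indicator_def\<close>)
    finally show ?thesis .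
  qed
  have "integral\<^sup>L lborel G = (LINT t|lborel. LINT x|lborel. G (x, t))"
    using lborel_pair.integral_snd[of "\<lambda>x t. G (x, t)"] int(3) by (simp add: lborel_prod)
  also have "\<dots> = 0"
    using line by simp
  finally have "integral\<^sup>L lborel G1 = - integral\<^sup>L lborel G2"
    using int unfolding G_def by (simp add: eq_neg_iff_add_eq_0 add.commute)
  then show "(LINT z|lebesgue. dx \<phi> z *\<^sub>R v z) = - (LINT z|lebesgue. \<phi> z *\<^sub>R w z)"
    using int by (simp add: integral_completion borel_measurable_integrable G1_def [abs_def]
        G2_def [abs_def])
qed

text \<open>For x different from 0 the argument x / sqrt t tends to plus or minus infinity with the
  sign of x. Dominated convergence with the majorant 2 |\<phi>| then gives the convergence in
  L1.\<close>

lemma attains_initial_parabolic: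
  assumes cont: "continuous_on UNIV f" and norm: "\<And>s. norm (f s) \<le> 1"
    and top: "(f \<longlongrightarrow> Ap) at_top" and bot: "(f \<longlongrightarrow> Am) at_bot"
  shows "attains_initial (jump_data Ap Am) (parabolic f)"
  unfolding attains_initial_def
proof (intro allI impI)
  fix \<phi> :: "real \<Rightarrow> real" assume \<phi>: "test_function UNIV \<phi>"
  have "norm Ap \<le> 1" "norm Am \<le> 1"
    using tendsto_upperbound[OF tendsto_norm[OF top]] tendsto_upperbound[OF tendsto_norm[OF bot]] norm
    by auto
  then have jump: "norm (jump_data Ap Am x) \<le> 1" for x
    by (auto simp: jump_data_def indicator_def)
  have f_meas [measurable]: "f \<in> borel_measurable borel"
    by (rule borel_measurable_continuous_onI[OF cont])
  have \<phi>_meas [measurable]: "\<phi> \<in> borel_measurable borel"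
    by (rule borel_measurable_continuous_onI[OF test_function_differentiable(3)[OF \<phi>]])
  have jump_meas [measurable]: "jump_data Ap Am \<in> borel_measurable borel"
    unfolding jump_data_def [abs_def] by measurable
  let ?u = "\<lambda>t x. ennreal (norm (\<phi> x *\<^sub>R (parabolic f (x, t) - jump_data Ap Am x)))"
  show "((\<lambda>t. \<integral>\<^sup>+x. ?u t x \<partial>lebesgue) \<longlongrightarrow> 0) (at_right 0)"
  \<comment> \<open>The passage to sequences is for the sake of dominated convergence.\<close>
  proof (rule tendsto_at_right_sequentially[of 0 1])
    fix S :: "nat \<Rightarrow> real"
    assume S: "\<And>n. 0 < S n" "S \<longlonglongrightarrow> 0"
    have S': "filterlim (\<lambda>n. 1 / sqrt (S n)) at_top sequentially"
    proof -
      have "(\<lambda>n. sqrt (S n)) \<longlonglongrightarrow> 0"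
        using tendsto_real_sqrt[OF S(2)] by simp
      then show ?thesis
        using S(1) by (intro LIM_at_top_divide[of _ 1]) (auto intro!: tendsto_intros always_eventually)
    qed
    have lim: "(\<lambda>n. ?u (S n) x) \<longlonglongrightarrow> 0" if "x \<noteq> 0" for x
    proof -
      have "(\<lambda>n. f (x / sqrt (S n))) \<longlonglongrightarrow> jump_data Ap Am x"
      proof (cases "0 < x")
        case True
        have "filterlim (\<lambda>n. x * (1 / sqrt (S n))) at_top sequentially"
          by (rule filterlim_tendsto_pos_mult_at_top[OF tendsto_const True S'])
        from filterlim_compose[OF top this] show ?thesis
          using True by (simp add: jump_data_def)
      next
        case False
        then have "x < 0" using that by simp
        then have "filterlim (\<lambda>n. x * (1 / sqrt (S n))) at_bot sequentially"
          by (intro filterlim_tendsto_neg_mult_at_bot[OF tendsto_const _ S'])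
        from filterlim_compose[OF bot this] show ?thesis
          using \<open>x < 0\<close> by (simp add: jump_data_def)
      qed
      then have "(\<lambda>n. norm (\<phi> x *\<^sub>R (parabolic f (x, S n) - jump_data Ap Am x))) \<longlonglongrightarrow>
          norm (\<phi> x *\<^sub>R (jump_data Ap Am x - jump_data Ap Am x))"
        unfolding parabolic_Pair by (intro tendsto_intros)
      from tendsto_ennrealI[OF this] show ?thesis by simp
    qed
    have "(\<lambda>n. \<integral>\<^sup>+x. ?u (S n) x \<partial>lborel) \<longlonglongrightarrow> (\<integral>\<^sup>+x. 0 \<partial>(lborel :: real measure))"
    proof (rule nn_integral_dominated_convergence[where w = "\<lambda>x. ennreal (norm (2 * \<phi> x))"])
      show "?u (S i) \<in> borel_measurable lborel" for i
        by simp
      show "AE x in lborel. ?u (S j) x \<le> ennreal (norm (2 * \<phi> x))" for j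
      proof (intro AE_I2 ennreal_leI)
        fix x
        have "norm (parabolic f (x, S j) - jump_data Ap Am x) \<le> 1 + 1"
          by (rule order_trans[OF norm_triangle_ineq4 add_mono]) (simp_all add: norm jump)
        then show "norm (\<phi> x *\<^sub>R (parabolic f (x, S j) - jump_data Ap Am x)) \<le> norm (2 * \<phi> x)"
          using mult_left_mono[of _ 2 "\<bar>\<phi> x\<bar>"] by (simp add: abs_mult mult.commute[of 2])
      qed
      have "integrable lborel (\<lambda>x. 2 * \<phi> x)"
        by (intro integrable_mult_right test_function_integrable[OF \<phi>])
      then show "(\<integral>\<^sup>+x. ennreal (norm (2 * \<phi> x)) \<partial>lborel) < \<infinity>"
        unfolding integrable_iff_bounded by blast
      \<comment> \<open>At x = 0 the lift stays at \<open>f 0\<close> while the datum is 0, so this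
        single point has to be discarded.\<close>
      have "AE x in lborel. x \<noteq> (0::real)"
        by (rule AE_lborel_singleton)
      then show "AE x in lborel. (\<lambda>i. ?u (S i) x) \<longlonglongrightarrow> 0"
        by (rule AE_mp) (use lim in \<open>auto intro!: AE_I2\<close>)
    qed simp_all
    then show "(\<lambda>n. \<integral>\<^sup>+x. ?u (S n) x \<partial>lebesgue) \<longlonglongrightarrow> 0"
      by (simp add: nn_integral_completion)
  qed simp
qed

section \<open>The space X\<close>

lemma ennreal_sqrt_le:
  assumes "a \<le> ennreal b"
  shows "ennreal_sqrt a \<le> ennreal (sqrt b)"
proof -
  have "a \<noteq> \<infinity>"
    using assms by (auto simp: top_unique)
  \<comment> \<open>A negative \<open>b\<close> would make \<open>ennreal b\<close> zero and force
    \<open>a = 0\<close>; hence the case distinction on \<open>a\<close>.\<close>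
  moreover have "enn2real a \<le> b" if "a \<noteq> 0"
    using assms that by (cases a; cases "0 \<le> b") (auto simp: ennreal_neg)
  ultimately show ?thesis
    by (cases "a = 0") (auto simp: ennreal_sqrt_def intro!: ennreal_leI)
qed

text \<open>Up to the factor c^2 the integrand is the squared norm of the space derivative of a
  lift. It is a multiple of the normal density of variance t / \<alpha>, and the right-hand side is
  that multiple.\<close>

lemma nn_integral_heat_kernel:
  fixes \<alpha> t :: real
  assumes "0 < \<alpha>" "0 < t"
  shows "(\<integral>\<^sup>+y. ennreal (exp (- \<alpha> * y\<^sup>2 / (2 * t)) / t) \<partial>lborel) =
    ennreal (sqrt (2 * pi / \<alpha>) * t powr (- 1 / 2))"
proof -
  define C where "C = sqrt (2 * pi / \<alpha>) * t powr (- 1 / 2)"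
  have "exp (- \<alpha> * y\<^sup>2 / (2 * t)) / t = C * normal_density 0 (sqrt (t / \<alpha>)) y" for y
  proof -
    have "sqrt (2 * pi * (t / \<alpha>)) = sqrt (2 * pi / \<alpha>) * sqrt t"
      by (simp add: real_sqrt_mult[symmetric])
    moreover have "t powr (- 1 / 2) = sqrt t / t"
      using assms by (simp add: powr_minus powr_half_sqrt field_simps)
    ultimately have 1: "C / sqrt (2 * pi * (t / \<alpha>)) = 1 / t"
      using assms by (simp add: C_def)
    have 2: "- \<alpha> * y\<^sup>2 / (2 * t) = - (y - 0)\<^sup>2 / (2 * (t / \<alpha>))"
      using assms by (simp add: field_simps)
    have 3: "(sqrt (t / \<alpha>))\<^sup>2 = t / \<alpha>"
      using assms by simp
    have "C * normal_density 0 (sqrt (t / \<alpha>)) y =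
        C / sqrt (2 * pi * (t / \<alpha>)) * exp (- \<alpha> * y\<^sup>2 / (2 * t))"
      unfolding normal_density_def 2 3 by simp
    then show ?thesis
      unfolding 1 by simp
  qed
  then have "(\<integral>\<^sup>+y. ennreal (exp (- \<alpha> * y\<^sup>2 / (2 * t)) / t) \<partial>lborel) =
      (\<integral>\<^sup>+y. ennreal C * ennreal (normal_density 0 (sqrt (t / \<alpha>)) y) \<partial>lborel)"
    using assms by (simp add: ennreal_mult[symmetric] C_def)
  also have "\<dots> = ennreal C"
    using assms by (subst nn_integral_cmult) (auto simp: nn_integral_eq_integral)
  finally show ?thesis by (simp add: C_def)
qed

lemma heat_kernel_measurable [measurable]:
  fixes \<alpha> r :: real
  shows "(\<lambda>z. ennreal (exp (- \<alpha> * (fst z)\<^sup>2 / (2 * snd z)) / snd z) * indicator (UNIV \<times> {0<..r\<^sup>2}) z)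
    \<in> borel_measurable borel"
  unfolding borel_prod[symmetric] by measurable

text \<open>Extending the window to the whole line costs nothing in scaling: the Gaussian integral
  is of order \<open>t powr (- 1 / 2)\<close>, whose integral over \<open>[0, r\<^sup>2]\<close> is
  2 r. This matches the factor 1 / r in the seminorm.\<close>

lemma nn_integral_parabolic_cylinder:
  fixes \<alpha> r :: real
  assumes "0 < \<alpha>" "0 < r"
  shows "(\<integral>\<^sup>+z. ennreal (exp (- \<alpha> * (fst z)\<^sup>2 / (2 * snd z)) / snd z) * indicator (UNIV \<times> {0<..r\<^sup>2}) z \<partial>lborel)
    = ennreal (2 * sqrt (2 * pi / \<alpha>) * r)" (is "integral\<^sup>N _ ?h = _")
proof -
  have "integral\<^sup>N lborel ?h = (\<integral>\<^sup>+t. (\<integral>\<^sup>+y. ?h (y, t) \<partial>lborel) \<partial>lborel)"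
    unfolding lborel_prod[symmetric]
    by (rule lborel_pair.nn_integral_snd[symmetric])
      (use heat_kernel_measurable[of \<alpha> r] in \<open>simp add: lborel_prod\<close>)
  \<comment> \<open>The end point t = 0 may be added because \<open>0 powr a\<close> is 0.\<close>
  also have "\<dots> = (\<integral>\<^sup>+t. ennreal (sqrt (2 * pi / \<alpha>) * t powr (- 1 / 2)) * indicator {0..r\<^sup>2} t \<partial>lborel)"
  proof (rule nn_integral_cong)
    fix t :: real
    show "(\<integral>\<^sup>+y. ?h (y, t) \<partial>lborel) =
        ennreal (sqrt (2 * pi / \<alpha>) * t powr (- 1 / 2)) * indicator {0..r\<^sup>2} t"
    proof (cases "0 < t \<and> t \<le> r\<^sup>2")
      case True
      then show ?thesis
        using nn_integral_heat_kernel[OF assms(1), of t] by simp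
    qed (auto simp: indicator_def)
  qed
  also have "\<dots> = ennreal (sqrt (2 * pi / \<alpha>) * ((r\<^sup>2) powr (- 1 / 2 + 1) / (- 1 / 2 + 1)))"
    using assms has_integral_powr_from_0[of "- 1 / 2" "r\<^sup>2"]
    by (intro nn_integral_has_integral_lebesgue' has_integral_mult_right) auto
  also have "(r\<^sup>2) powr (- 1 / 2 + 1) = r"
    using assms by (simp add: powr_half_sqrt)
  finally show ?thesis by (simp add: mult_ac)
qed

context frenet_frame
begin

lemma norm_dx_parabolic:
  assumes "0 \<le> c" "0 \<le> t"
  shows "norm (dx (parabolic f) (x, t)) = curvature c \<alpha> (x / sqrt t) / sqrt t"
  using assms by (simp add: dx_parabolic curvature_nonneg)

lemma continuous_on_dx_parabolic_slice: "continuous_on S (\<lambda>x. dx (parabolic f) (x, t))"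
  unfolding dx_parabolic curvature_def divide_inverse
  by (intro continuous_intros continuous_on_compose2[OF continuous_frenet(2)[of UNIV]]) auto

text \<open>The exponential factor of the curvature is maximal at x = 0, where it is 1, so the
  supremum is attained and the speed comes out exactly.\<close>

lemma Linf_norm_dx_parabolic:
  assumes "0 \<le> c" "0 \<le> \<alpha>" "0 < t"
  shows "Linf_norm (\<lambda>x. dx (parabolic f) (x, t)) = ennreal (c / sqrt t)"
proof -
  have "norm (dx (parabolic f) (x, t)) \<le> norm (dx (parabolic f) (0, t))" for x
  proof -
    have "exp (- \<alpha> * (x / sqrt t)\<^sup>2 / 4) \<le> 1"
      using assms by simp
    then have "c * exp (- \<alpha> * (x / sqrt t)\<^sup>2 / 4) \<le> c * 1"
      using assms by (intro mult_left_mono) auto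
    then show ?thesis
      using assms by (simp add: norm_dx_parabolic curvature_def divide_right_mono)
  qed
  from Linf_norm_attained[OF continuous_on_dx_parabolic_slice this] show ?thesis
    using assms by (simp add: norm_dx_parabolic) (simp add: curvature_def)
qed

lemma scaled_Linf_norm_dx_parabolic:
  assumes "0 \<le> c" "0 \<le> \<alpha>" "0 < t"
  shows "ennreal (sqrt t) * Linf_norm (\<lambda>x. dx (parabolic f) (x, t)) = ennreal c"
  using assms by (simp add: Linf_norm_dx_parabolic ennreal_mult[symmetric])

text \<open>Squaring the exponential in the curvature doubles its exponent and gives the kernel
  integrated above; after division by \<open>r\<close> the bound is the same for all
  cylinders.\<close>

lemma Carleson_dx_parabolic:
  assumes "0 \<le> c" "0 < \<alpha>" "0 < r"
  shows "ennreal (1 / r) * (\<integral>\<^sup>+z\<in>{x - r<..<x + r} \<times> {0..r\<^sup>2}.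
      ennreal ((norm (dx (parabolic f) z))\<^sup>2) \<partial>lebesgue) \<le> ennreal (2 * c\<^sup>2 * sqrt (2 * pi / \<alpha>))"
proof -
  let ?h = "\<lambda>z. ennreal (exp (- \<alpha> * (fst z)\<^sup>2 / (2 * snd z)) / snd z) * indicator (UNIV \<times> {0<..r\<^sup>2}) z"
  have "(\<integral>\<^sup>+z\<in>{x - r<..<x + r} \<times> {0..r\<^sup>2}. ennreal ((norm (dx (parabolic f) z))\<^sup>2) \<partial>lebesgue) \<le>
      (\<integral>\<^sup>+z. ennreal (c\<^sup>2) * ?h z \<partial>lborel)"
    unfolding nn_integral_completion
  proof (rule nn_integral_mono)
    fix z :: "real \<times> real"
    obtain y t where z: "z = (y, t)" by (cases z)
    consider "0 < t" | "t = 0" | "t < 0" by linarith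
    then show "ennreal ((norm (dx (parabolic f) z))\<^sup>2) * indicator ({x - r<..<x + r} \<times> {0..r\<^sup>2}) z \<le>
        ennreal (c\<^sup>2) * ?h z"
    proof cases
      case 1
      have "(exp (- \<alpha> * (y / sqrt t)\<^sup>2 / 4))\<^sup>2 = exp (- \<alpha> * y\<^sup>2 / (2 * t))"
        using 1 by (simp add: exp_double[symmetric] power_divide)
      then have "(norm (dx (parabolic f) z))\<^sup>2 = c\<^sup>2 * (exp (- \<alpha> * y\<^sup>2 / (2 * t)) / t)"
        using 1 assms by (simp add: z norm_dx_parabolic curvature_def power_divide power_mult_distrib)
      then show ?thesis
        using 1 by (auto simp: z indicator_def ennreal_mult[symmetric])
    next
      \<comment> \<open>The closed cylinder contains the line t = 0. There the lift is constant in
        x, as division by \<open>sqrt 0\<close> gives 0.\<close>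
      case 2
      then show ?thesis by (simp add: z dx_parabolic)
    qed (simp add: z)
  qed
  also have "\<dots> = ennreal (c\<^sup>2) * ennreal (2 * sqrt (2 * pi / \<alpha>) * r)"
    using assms nn_integral_parabolic_cylinder[of \<alpha> r] heat_kernel_measurable[of \<alpha> r]
    by (subst nn_integral_cmult) auto
  finally have "ennreal (1 / r) * (\<integral>\<^sup>+z\<in>{x - r<..<x + r} \<times> {0..r\<^sup>2}.
      ennreal ((norm (dx (parabolic f) z))\<^sup>2) \<partial>lebesgue) \<le>
      ennreal (1 / r) * (ennreal (c\<^sup>2) * ennreal (2 * sqrt (2 * pi / \<alpha>) * r))"
    by (rule mult_left_mono) simp
  also have "\<dots> = ennreal (2 * c\<^sup>2 * sqrt (2 * pi / \<alpha>))"
    using assms by (simp add: ennreal_mult[symmetric])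
  finally show ?thesis .
qed

text \<open>The classical derivative is the witness for the weak one. The parts of the norm are
  bounded by 1, by c and by the square root of the cylinder bound.\<close>

lemma parabolic_in_X_space:
  assumes "0 \<le> c" "0 < \<alpha>"
  shows "parabolic f \<in> X_space"
proof -
  have quot: "continuous_on half_plane (\<lambda>z. fst z / sqrt (snd z))"
    by (auto intro!: continuous_intros)
  have "continuous_on half_plane (\<lambda>z. f (fst z / sqrt (snd z)))"
    by (intro continuous_on_compose2[OF continuous_frenet(1)[of UNIV] quot]) auto
  then have v: "continuous_on half_plane (parabolic f)"
    by (simp add: parabolic_def case_prod_unfold)
  have "continuous_on half_plane (\<lambda>z. (curvature c \<alpha> (fst z / sqrt (snd z)) / sqrt (snd z)) *\<^sub>R
      p (fst z / sqrt (snd z)))"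
    unfolding curvature_def
    by (intro continuous_intros quot continuous_on_compose2[OF continuous_frenet(2)[of UNIV] quot]) auto
  also have "(\<lambda>z. (curvature c \<alpha> (fst z / sqrt (snd z)) / sqrt (snd z)) *\<^sub>R
      p (fst z / sqrt (snd z))) = dx (parabolic f)"
    by (simp add: fun_eq_iff dx_parabolic)
  finally have w: "continuous_on half_plane (dx (parabolic f))" .
  have "weak_dx (parabolic f) (dx (parabolic f))"
  proof (rule weak_dx_classical[OF v w])
    show "((\<lambda>y. parabolic f (y, t)) has_vector_derivative dx (parabolic f) (x, t)) (at x)" for x t
      by (rule has_vector_derivative_eq_rhs[OF has_vector_derivative_parabolic_x[OF deriv_f]])
        (simp add: dx_parabolic)
  qed
  moreover have "X_norm (parabolic f) (dx (parabolic f)) \<le>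
      ennreal 1 + (ennreal c + ennreal (sqrt (2 * c\<^sup>2 * sqrt (2 * pi / \<alpha>))))"
    unfolding X_norm_def X_seminorm_def
  proof (intro add_mono SUP_least)
    show "Linf_norm (\<lambda>x. parabolic f (x, t)) \<le> ennreal 1" for t
      unfolding parabolic_Pair divide_inverse
      by (intro Linf_norm_le continuous_on_compose2[OF continuous_frenet(1)[of UNIV]] continuous_intros) auto
    show "ennreal (sqrt t) * Linf_norm (\<lambda>x. dx (parabolic f) (x, t)) \<le> ennreal c"
      if "t \<in> {0<..}" for t
      using scaled_Linf_norm_dx_parabolic[of t] assms that by simp
    show "(case z of (x, r) \<Rightarrow> ennreal_sqrt (ennreal (1 / r) *
        (\<integral>\<^sup>+z\<in>{x - r<..<x + r} \<times> {0..r\<^sup>2}. ennreal ((norm (dx (parabolic f) z))\<^sup>2) \<partial>lebesgue)))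
        \<le> ennreal (sqrt (2 * c\<^sup>2 * sqrt (2 * pi / \<alpha>)))" if "z \<in> half_plane" for z
      using that Carleson_dx_parabolic[OF assms] by (auto intro!: ennreal_sqrt_le)
  qed
  then have "X_norm (parabolic f) (dx (parabolic f)) < \<infinity>"
    by (rule order_le_less_trans) simp
  ultimately show ?thesis
    using locally_integrable_continuous[OF v] locally_integrable_continuous[OF w]
    unfolding X_space_def by (auto simp: parabolic_def)
qed

theorem ss_solution_parabolic:
  assumes "0 \<le> c" "0 < \<alpha>" "\<alpha> \<le> 1" and "(f \<longlongrightarrow> Ap) at_top" and "(f \<longlongrightarrow> Am) at_bot"
  shows "ss_solution \<alpha> Ap Am (parabolic f)"
  unfolding ss_solution_def smooth_solution_def
  using parabolic_in_X_space[OF assms(1,2)] smooth_on_parabolic_frame LLG_parabolic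
    self_similar_parabolic[of f]
    attains_initial_parabolic[OF continuous_frenet(1) _ assms(4,5)] assms
  by (auto simp: parabolic_def)

end

section \<open>Dependence on the parameters\<close>

lemma abs_exp_minus_diff_le:
  fixes a b :: real
  assumes "0 \<le> a" "0 \<le> b"
  shows "\<bar>exp (- a) - exp (- b)\<bar> \<le> \<bar>a - b\<bar>"
proof -
  have *: "exp (- a) - exp (- b) \<le> b - a" if "a \<le> b" "0 \<le> a" for a b :: real
  proof -
    have "exp (- a) - exp (- b) = exp (- a) * (1 - exp (- (b - a)))"
      by (simp add: right_diff_distrib exp_add[symmetric])
    also have "\<dots> \<le> 1 * (b - a)"
    proof (rule mult_mono)
      show "1 - exp (- (b - a)) \<le> b - a"
        using exp_ge_add_one_self[of "- (b - a)"] by linarith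
    qed (use that in auto)
    finally show ?thesis by simp
  qed
  show ?thesis
    using *[of a b] *[of b a] assms by (cases "a \<le> b") (auto simp: abs_if)
qed

lemma abs_curvature_diff_le:
  assumes "0 \<le> \<alpha>1" "0 \<le> \<alpha>2" "0 \<le> s" "s \<le> S"
  shows "\<bar>curvature c1 \<alpha>1 s - curvature c2 \<alpha>2 s\<bar> \<le> \<bar>c1 - c2\<bar> + \<bar>c2\<bar> * (\<bar>\<alpha>1 - \<alpha>2\<bar> * S\<^sup>2)"
proof -
  have e: "exp (- \<alpha>1 * s\<^sup>2 / 4) \<le> 1"
    using assms by simp
  have "\<bar>exp (- (\<alpha>1 * s\<^sup>2 / 4)) - exp (- (\<alpha>2 * s\<^sup>2 / 4))\<bar> \<le> \<bar>\<alpha>1 * s\<^sup>2 / 4 - \<alpha>2 * s\<^sup>2 / 4\<bar>"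
    using assms by (intro abs_exp_minus_diff_le) auto
  also have "\<dots> = \<bar>\<alpha>1 - \<alpha>2\<bar> * (s\<^sup>2 / 4)"
    unfolding times_divide_eq_right[symmetric] left_diff_distrib[symmetric] abs_mult by simp
  also have "\<dots> \<le> \<bar>\<alpha>1 - \<alpha>2\<bar> * S\<^sup>2"
  proof (rule mult_left_mono)
    show "s\<^sup>2 / 4 \<le> S\<^sup>2"
      using assms power_mono[of s S 2] zero_le_power2[of S] by linarith
  qed simp
  finally have d: "\<bar>exp (- \<alpha>1 * s\<^sup>2 / 4) - exp (- \<alpha>2 * s\<^sup>2 / 4)\<bar> \<le> \<bar>\<alpha>1 - \<alpha>2\<bar> * S\<^sup>2"
    by simp
  \<comment> \<open>The parameters are changed one at a time, c first and then \<alpha>.\<close>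
  have "curvature c1 \<alpha>1 s - curvature c2 \<alpha>2 s =
      (c1 - c2) * exp (- \<alpha>1 * s\<^sup>2 / 4) + c2 * (exp (- \<alpha>1 * s\<^sup>2 / 4) - exp (- \<alpha>2 * s\<^sup>2 / 4))"
    by (simp add: curvature_def algebra_simps)
  also have "\<bar>\<dots>\<bar> \<le> \<bar>c1 - c2\<bar> * exp (- \<alpha>1 * s\<^sup>2 / 4) +
      \<bar>c2\<bar> * \<bar>exp (- \<alpha>1 * s\<^sup>2 / 4) - exp (- \<alpha>2 * s\<^sup>2 / 4)\<bar>"
    by (rule order_trans[OF abs_triangle_ineq]) (simp add: abs_mult)
  also have "\<dots> \<le> \<bar>c1 - c2\<bar> * 1 + \<bar>c2\<bar> * (\<bar>\<alpha>1 - \<alpha>2\<bar> * S\<^sup>2)"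
    using e d by (intro add_mono mult_left_mono) auto
  finally show ?thesis by simp
qed

text \<open>No Gronwall argument is needed: the frames are orthonormal, so the derivative of their pairing
  is controlled by the difference of the coefficients alone.\<close>

lemma frenet_frame_dependence:
  fixes c1 c2 \<alpha>1 \<alpha>2 S :: real
  defines "K \<equiv> \<bar>c1 - c2\<bar> + \<bar>c2\<bar> * (\<bar>\<alpha>1 - \<alpha>2\<bar> * S\<^sup>2) + \<bar>sqrt (1 - \<alpha>1\<^sup>2) - sqrt (1 - \<alpha>2\<^sup>2)\<bar> * S"
  assumes "frenet_frame c1 \<alpha>1 f1 p1 q1" and "frenet_frame c2 \<alpha>2 f2 p2 q2"
    and "f1 0 = f2 0" and "p1 0 = p2 0" and "q1 0 = q2 0"
    and "0 \<le> \<alpha>1" and "0 \<le> \<alpha>2" and "0 \<le> S"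
  shows "norm (f1 S - f2 S) \<le> sqrt (4 * K * S)"
proof -
  interpret A: frenet_frame c1 \<alpha>1 f1 p1 q1 by fact
  interpret B: frenet_frame c2 \<alpha>2 f2 p2 q2 by fact
  \<comment> \<open>The trace of the rotation from one frame to the other: it is 3 exactly if the
    frames agree, and \<open>6 - 2 * h s\<close> is their squared distance.\<close>
  define h where "h s = f1 s \<bullet> f2 s + p1 s \<bullet> p2 s + q1 s \<bullet> q2 s" for s
  define h' where "h' s = (curvature c1 \<alpha>1 s - curvature c2 \<alpha>2 s) * (p1 s \<bullet> f2 s - f1 s \<bullet> p2 s) +
      (torsion \<alpha>1 s - torsion \<alpha>2 s) * (q1 s \<bullet> p2 s - p1 s \<bullet> q2 s)" for s
  have h': "(h has_field_derivative h' s) (at s)" for s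
    unfolding h_def h'_def
    by (rule frenet_pairing_derivative) (use assms in \<open>simp_all add: frenet_frame.axioms\<close>)
  have cs: "\<bar>u \<bullet> v - u' \<bullet> v'\<bar> \<le> 2" if "norm u = 1" "norm v = 1" "norm u' = 1" "norm v' = 1"
    for u v u' v' :: "real^3"
    using Cauchy_Schwarz_ineq2[of u v] Cauchy_Schwarz_ineq2[of u' v'] that by auto
  have norm_diff: "(norm (u - v))\<^sup>2 = 2 - 2 * (u \<bullet> v)" if "norm u = 1" "norm v = 1" for u v :: "real^3"
    using that by (simp add: power2_norm_eq_inner inner_simps inner_commute norm_eq_1)
  have "\<bar>h' s\<bar> \<le> 2 * K" if "0 \<le> s" "s \<le> S" for s
  proof -
    have "\<bar>torsion \<alpha>1 s - torsion \<alpha>2 s\<bar> = \<bar>sqrt (1 - \<alpha>1\<^sup>2) - sqrt (1 - \<alpha>2\<^sup>2)\<bar> * (s / 2)"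
      using that by (simp add: torsion_def left_diff_distrib[symmetric] diff_divide_distrib[symmetric] abs_mult)
    also have "\<dots> \<le> \<bar>sqrt (1 - \<alpha>1\<^sup>2) - sqrt (1 - \<alpha>2\<^sup>2)\<bar> * S"
      using that by (intro mult_left_mono) auto
    finally have t: "\<bar>torsion \<alpha>1 s - torsion \<alpha>2 s\<bar> \<le> \<bar>sqrt (1 - \<alpha>1\<^sup>2) - sqrt (1 - \<alpha>2\<^sup>2)\<bar> * S" .
    have w: "\<bar>curvature c1 \<alpha>1 s - curvature c2 \<alpha>2 s\<bar> \<le> \<bar>c1 - c2\<bar> + \<bar>c2\<bar> * (\<bar>\<alpha>1 - \<alpha>2\<bar> * S\<^sup>2)"
      using assms that by (intro abs_curvature_diff_le) auto
    have "\<bar>h' s\<bar> \<le> \<bar>curvature c1 \<alpha>1 s - curvature c2 \<alpha>2 s\<bar> * \<bar>p1 s \<bullet> f2 s - f1 s \<bullet> p2 s\<bar> +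
        \<bar>torsion \<alpha>1 s - torsion \<alpha>2 s\<bar> * \<bar>q1 s \<bullet> p2 s - p1 s \<bullet> q2 s\<bar>"
      unfolding h'_def by (rule order_trans[OF abs_triangle_ineq]) (simp add: abs_mult)
    also have "\<dots> \<le> (\<bar>c1 - c2\<bar> + \<bar>c2\<bar> * (\<bar>\<alpha>1 - \<alpha>2\<bar> * S\<^sup>2)) * 2 +
        (\<bar>sqrt (1 - \<alpha>1\<^sup>2) - sqrt (1 - \<alpha>2\<^sup>2)\<bar> * S) * 2"
      using assms by (intro add_mono mult_mono w t cs) auto
    also have "\<dots> = 2 * K"
      by (simp add: K_def)
    finally show ?thesis .
  qed
  then have "norm (h S - h 0) \<le> 2 * K * norm (S - 0)"
    using assms
    by (intro field_differentiable_bound[where S = "{0..S}" and f' = h'])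
      (auto intro: has_field_derivative_at_within h')
  moreover have "h 0 = 3"
    using assms by (simp add: h_def norm_eq_1[symmetric] dot_square_norm B.norm_f B.norm_p B.norm_q)
  ultimately have h: "3 - h S \<le> 2 * K * S"
    using assms by (simp add: abs_le_iff)
  have "(norm (f1 S - f2 S))\<^sup>2 \<le> (norm (f1 S - f2 S))\<^sup>2 + (norm (p1 S - p2 S))\<^sup>2 + (norm (q1 S - q2 S))\<^sup>2"
    by simp
  also have "\<dots> = 6 - 2 * h S"
    by (simp add: h_def norm_diff)
  also have "\<dots> \<le> 4 * K * S"
    using h by simp
  finally show ?thesis
    by (rule real_le_rsqrt)
qed

lemma continuous_on_profile:
  assumes "0 \<le> S"
  shows "continuous_on (UNIV \<times> {0..}) (\<lambda>z. profile (fst z) (snd z) S)"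
  unfolding continuous_on_def
proof
  fix z0 :: "real \<times> real" assume z0: "z0 \<in> UNIV \<times> {0..}"
  \<comment> \<open>The bound of \<open>frenet_frame_dependence\<close> as a function of the varying
    parameters. It is continuous everywhere, since \<open>sqrt\<close> is defined and continuous on
    all reals, and it vanishes at \<open>z0\<close>.\<close>
  define M where "M z = sqrt (4 * (\<bar>fst z - fst z0\<bar> + \<bar>fst z0\<bar> * (\<bar>snd z - snd z0\<bar> * S\<^sup>2) +
      \<bar>sqrt (1 - (snd z)\<^sup>2) - sqrt (1 - (snd z0)\<^sup>2)\<bar> * S) * S)" for z
  have "continuous_on UNIV M"
    unfolding M_def by (intro continuous_intros)
  then have "(M \<longlongrightarrow> M z0) (at z0)"
    unfolding continuous_on_def by blast
  moreover have "M z0 = 0"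
    by (simp add: M_def)
  ultimately have M: "(M \<longlongrightarrow> 0) (at z0 within UNIV \<times> {0..})"
    using tendsto_within_subset by fastforce
  have "norm (profile (fst z) (snd z) S - profile (fst z0) (snd z0) S) \<le> M z"
    if "z \<in> UNIV \<times> {0..}" for z
  proof -
    obtain p q where 1: "frenet_frame (fst z) (snd z) (profile (fst z) (snd z)) p q"
      "profile (fst z) (snd z) 0 = vector [1, 0, 0]" "p 0 = vector [0, 1, 0]" "q 0 = vector [0, 0, 1]"
      by (rule profile_frame)
    obtain p' q' where 2: "frenet_frame (fst z0) (snd z0) (profile (fst z0) (snd z0)) p' q'"
      "profile (fst z0) (snd z0) 0 = vector [1, 0, 0]" "p' 0 = vector [0, 1, 0]" "q' 0 = vector [0, 0, 1]"
      by (rule profile_frame)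
    show ?thesis
      unfolding M_def by (rule frenet_frame_dependence[OF 1(1) 2(1)]) (use 1 2 that z0 assms in auto)
  qed
  then have "\<forall>\<^sub>F z in at z0 within UNIV \<times> {0..}.
      norm (profile (fst z) (snd z) S - profile (fst z0) (snd z0) S) \<le> M z"
    by (auto simp: eventually_at_filter)
  from Lim_null_comparison[OF this M]
  show "((\<lambda>z. profile (fst z) (snd z) S) \<longlongrightarrow> profile (fst z0) (snd z0) S) (at z0 within UNIV \<times> {0..})"
    by (simp add: Lim_null[symmetric])
qed

section \<open>Limits of the profile at infinity and their continuity in the parameters\<close>

definition profile_limit :: "real \<Rightarrow> real \<Rightarrow> real^3" where
  "profile_limit c \<alpha> = Lim at_top (profile c \<alpha>)"

lemma profile_limit:
  assumes "0 \<le> c" "0 < \<alpha>"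
  shows "(profile c \<alpha> \<longlongrightarrow> profile_limit c \<alpha>) at_top"
    and "norm (profile_limit c \<alpha> - profile c \<alpha> S) \<le> c / \<alpha> * exp (\<alpha> * (1 - S))"
proof -
  obtain p q where "frenet_frame c \<alpha> (profile c \<alpha>) p q"
    by (rule profile_frame)
  from frenet_frame.limit_at_top[OF this assms]
  obtain L where L: "(profile c \<alpha> \<longlongrightarrow> L) at_top"
    "\<And>S. norm (L - profile c \<alpha> S) \<le> c / \<alpha> * exp (\<alpha> * (1 - S))"
    by blast
  have "profile_limit c \<alpha> = L"
    unfolding profile_limit_def by (rule tendsto_Lim[OF _ L(1)]) simp
  then show "(profile c \<alpha> \<longlongrightarrow> profile_limit c \<alpha>) at_top"
    "norm (profile_limit c \<alpha> - profile c \<alpha> S) \<le> c / \<alpha> * exp (\<alpha> * (1 - S))"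
    using L by simp_all
qed

lemma norm_profile_limit:
  assumes "0 \<le> c" "0 < \<alpha>"
  shows "norm (profile_limit c \<alpha>) = 1"
proof -
  obtain p q where "frenet_frame c \<alpha> (profile c \<alpha>) p q"
    by (rule profile_frame)
  then have "norm (profile c \<alpha> s) = 1" for s
    by (rule frenet_frame.norm_f)
  then show ?thesis
    using tendsto_unique[OF _ tendsto_norm[OF profile_limit(1)[OF assms]], of 1] by simp
qed

text \<open>A uniform limit of continuous functions: for c at most \<open>C\<close> and \<alpha> at
  least \<open>a\<close> the tail rate is controlled by its value at \<open>C\<close> and
  \<open>a\<close>.\<close>

lemma continuous_on_profile_limit:
  fixes C a :: real
  assumes "0 < a"
  shows "continuous_on ({0..C} \<times> {a..}) (\<lambda>z. profile_limit (fst z) (snd z))"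
proof (rule uniform_limit_theorem)
  show "\<forall>\<^sub>F n in sequentially. continuous_on ({0..C} \<times> {a..}) (\<lambda>z. profile (fst z) (snd z) (real n))"
    using assms by (auto intro!: always_eventually continuous_on_subset[OF continuous_on_profile])
  show "uniform_limit ({0..C} \<times> {a..}) (\<lambda>n z. profile (fst z) (snd z) (real n))
      (\<lambda>z. profile_limit (fst z) (snd z)) sequentially"
  proof (rule uniform_limitI)
    fix e :: real assume "0 < e"
    have "((\<lambda>n. C / a * exp (a * (1 - real n))) \<longlonglongrightarrow> 0)"
      using assms by real_asymp
    then have "\<forall>\<^sub>F n in sequentially. C / a * exp (a * (1 - real n)) < e"
      using \<open>0 < e\<close> by (auto dest: order_tendstoD)
    then show "\<forall>\<^sub>F n in sequentially. \<forall>z\<in>{0..C} \<times> {a..}.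
        dist (profile (fst z) (snd z) (real n)) (profile_limit (fst z) (snd z)) < e"
      \<comment> \<open>For n at least 1 the factor 1 - n is nonpositive, so the exponential is
        largest at the smallest \<alpha>.\<close>
      using eventually_ge_at_top[of 1]
    proof eventually_elim
      case (elim n)
      have "dist (profile c \<alpha> (real n)) (profile_limit c \<alpha>) < e" if "0 \<le> c" "c \<le> C" "a \<le> \<alpha>" for c \<alpha>
      proof -
        have "dist (profile c \<alpha> (real n)) (profile_limit c \<alpha>) \<le> c / \<alpha> * exp (\<alpha> * (1 - real n))"
          using profile_limit(2)[of c \<alpha>] that assms by (simp add: dist_norm norm_minus_commute)
        also have "\<dots> \<le> C / a * exp (a * (1 - real n))"
          using that assms elim by (intro mult_mono frac_le) (auto intro!: mult_right_mono_neg)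
        finally show ?thesis using elim by simp
      qed
      then show ?case by auto
    qed
  qed
qed simp

text \<open>The rotation by pi about the first axis: it fixes the initial point of the profile and
  reverses the other two initial frame vectors.\<close>

definition half_turn :: "real^3^3" where
  "half_turn = vector [vector [1, 0, 0], vector [0, - 1, 0], vector [0, 0, - 1]]"

lemma half_turn_nth [simp]:
  "(half_turn *v v) $ 1 = v $ 1" "(half_turn *v v) $ 2 = - v $ 2" "(half_turn *v v) $ 3 = - v $ 3"
  by (simp_all add: half_turn_def matrix_vector_mult_def sum_3)

lemma rotation_matrix_half_turn: "rotation_matrix half_turn"
  unfolding rotation_matrix_def orthogonal_matrix half_turn_def
  by (simp add: det_3 matrix_matrix_mult_def transpose_def mat_def vec_eq_iff forall_3 sum_3)

text \<open>The reversed frame starts with the last two vectors negated. The half turn undoes this,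
  and uniqueness identifies the result with the profile.\<close>

lemma profile_minus: "profile c \<alpha> (- s) = half_turn *v profile c \<alpha> s"
proof -
  obtain p q where F: "frenet_frame c \<alpha> (profile c \<alpha>) p q"
    and 0: "profile c \<alpha> 0 = vector [1, 0, 0]" "p 0 = vector [0, 1, 0]" "q 0 = vector [0, 0, 1]"
    by (rule profile_frame)
  have inv: "half_turn *v (half_turn *v v) = v" for v
    by (simp add: vec_eq_iff forall_3)
  have "profile c \<alpha> = (\<lambda>s. half_turn *v profile c \<alpha> (- s))"
    by (rule profile_eqI[OF frenet_frame.axioms(1)[OF frenet_frame.frenet_frame_rotate[OF
            frenet_frame.frenet_frame_reflect[OF F] rotation_matrix_half_turn]]])
      (simp_all add: 0 vec_eq_iff forall_3)
  then show ?thesis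
    by (metis inv)
qed

lemma profile_limit_at_bot:
  assumes "0 \<le> c" "0 < \<alpha>"
  shows "(profile c \<alpha> \<longlongrightarrow> half_turn *v profile_limit c \<alpha>) at_bot"
proof -
  have "((\<lambda>s. half_turn *v profile c \<alpha> s) \<longlongrightarrow> half_turn *v profile_limit c \<alpha>) at_top"
    by (rule bounded_linear.tendsto[OF matrix_vector_mul_bounded_linear profile_limit(1)[OF assms]])
  then show ?thesis
    by (simp add: at_bot_mirror filterlim_filtermap profile_minus)
qed

text \<open>The rotated profile belongs to a rotated frame, so the results on lifts apply to it
  directly and neither the equation nor the norms have to be transformed.\<close>

theorem ss_solution_rotated_m_ss:
  assumes "0 \<le> c" "0 < \<alpha>" "\<alpha> \<le> 1" and R: "rotation_matrix R"
    and "R *v profile_limit c \<alpha> = Ap" and "R *v (half_turn *v profile_limit c \<alpha>) = Am"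
  shows "ss_solution \<alpha> Ap Am (\<lambda>z. R *v m_ss c \<alpha> z)"
    and "0 < t \<Longrightarrow> ennreal (sqrt t) * Linf_norm (\<lambda>x. dx (\<lambda>z. R *v m_ss c \<alpha> z) (x, t)) = ennreal c"
proof -
  obtain p q where "frenet_frame c \<alpha> (profile c \<alpha>) p q"
    by (rule profile_frame)
  then interpret frenet_frame c \<alpha> "\<lambda>s. R *v profile c \<alpha> s" "\<lambda>s. R *v p s" "\<lambda>s. R *v q s"
    using R by (rule frenet_frame.frenet_frame_rotate)
  have eq: "(\<lambda>z. R *v m_ss c \<alpha> z) = parabolic (\<lambda>s. R *v profile c \<alpha> s)"
    by (simp add: m_ss_eq_parabolic parabolic_def fun_eq_iff)
  note lim = bounded_linear.tendsto[OF matrix_vector_mul_bounded_linear[of R]]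
  show "ss_solution \<alpha> Ap Am (\<lambda>z. R *v m_ss c \<alpha> z)"
    unfolding eq
    using lim[OF profile_limit(1)[OF assms(1,2)]] lim[OF profile_limit_at_bot[OF assms(1,2)]] assms
    by (intro ss_solution_parabolic) auto
  show "ennreal (sqrt t) * Linf_norm (\<lambda>x. dx (\<lambda>z. R *v m_ss c \<alpha> z) (x, t)) = ennreal c" if "0 < t"
    unfolding eq using assms that by (intro scaled_Linf_norm_dx_parabolic) auto
qed

section \<open>Limits at infinity and rotations\<close>

text \<open>This is Erf after the substitution \<sigma> = 2 x, normalised so that the standard
  Gaussian integral over the half line gives its limit sqrt pi.\<close>

definition gauss_erf :: "real \<Rightarrow> real" where
  "gauss_erf s = 2 * (LBINT x=0..ereal (s / 2). exp (- x\<^sup>2))"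

lemma gauss_erf_0 [simp]: "gauss_erf 0 = 0"
  by (simp add: gauss_erf_def zero_ereal_def[symmetric])

lemma has_field_derivative_gauss_erf:
  "(gauss_erf has_field_derivative exp (- s\<^sup>2 / 4)) (at s)"
proof -
  have "((\<lambda>u. LBINT x=0..u. exp (- x\<^sup>2)) has_field_derivative exp (- (s / 2)\<^sup>2)) (at (s / 2))"
    unfolding has_real_derivative_iff_has_vector_derivative
    by (rule antiderivative_LBINT) (auto intro!: continuous_intros)
  from DERIV_cmult[OF DERIV_chain2[where g = "\<lambda>s. s / 2" and Db = "1 / 2", OF this], where c = 2]
  have "((\<lambda>s. 2 * (LBINT x=0..ereal (s / 2). exp (- x\<^sup>2))) has_field_derivative
      2 * (exp (- (s / 2)\<^sup>2) * (1 / 2))) (at s)"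
    by (rule meta_mp) (auto intro!: derivative_eq_intros)
  then show ?thesis
    by (simp add: gauss_erf_def [abs_def] power_divide)
qed

lemma gauss_erf_at_top: "(gauss_erf \<longlongrightarrow> sqrt pi) at_top"
proof -
  have I: "integrable lborel (\<lambda>x::real. indicator {0..} x *\<^sub>R exp (- x\<^sup>2))"
    and L: "(LINT x|lborel. indicator {0..} x *\<^sub>R exp (- x\<^sup>2)) = sqrt pi / (2::real)"
    using gaussian_moment_0 by (simp_all add: has_bochner_integral_iff)
  have "((\<lambda>y. LINT x|lborel. indicator {..y} x *\<^sub>R indicator {0..} x *\<^sub>R exp (- x\<^sup>2)) \<longlongrightarrow> sqrt pi / 2) at_top"
    using tendsto_integral_at_top[OF _ I] unfolding L by simp
  moreover have "\<forall>\<^sub>F y in at_top. (LINT x|lborel. indicator {..y} x *\<^sub>R indicator {0..} x *\<^sub>R exp (- x\<^sup>2)) =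
      (LBINT x=0..ereal y. exp (- x\<^sup>2))"
    using eventually_ge_at_top[of 0]
  proof eventually_elim
    case (elim y)
    then have "(LBINT x=0..ereal y. exp (- x\<^sup>2)) = (LINT x|lborel. indicator {0..y} x *\<^sub>R exp (- x\<^sup>2))"
      using interval_integral_Icc[of 0 y "\<lambda>x. exp (- x\<^sup>2)"]
      by (simp add: zero_ereal_def[symmetric] set_lebesgue_integral_def)
    moreover have "indicator {..y} x *\<^sub>R indicator {0..} x *\<^sub>R exp (- x\<^sup>2) = indicator {0..y} x *\<^sub>R exp (- x\<^sup>2)"
      for x :: real by (auto simp: indicator_def)
    ultimately show ?case by (simp only:)
  qed
  ultimately have "((\<lambda>y. LBINT x=0..ereal y. exp (- x\<^sup>2)) \<longlongrightarrow> sqrt pi / 2) at_top"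
    by (rule Lim_transform_eventually)
  moreover have "filterlim (\<lambda>s::real. s / 2) at_top at_top"
    by real_asymp
  ultimately have "((\<lambda>s. LBINT x=0..ereal (s / 2). exp (- x\<^sup>2)) \<longlongrightarrow> sqrt pi / 2) at_top"
    by (rule filterlim_compose)
  from tendsto_mult[OF tendsto_const[of 2] this] show ?thesis
    by (simp add: gauss_erf_def [abs_def])
qed

text \<open>Without torsion the third frame vector is constant and the curve runs on a great circle,
  its angle being the integral of the curvature.\<close>

lemma profile_1:
  "profile c 1 s = cos (c * gauss_erf s) *\<^sub>R vector [1, 0, 0] + sin (c * gauss_erf s) *\<^sub>R vector [0, 1, 0]"
proof -
  let ?f = "\<lambda>s. cos (c * gauss_erf s) *\<^sub>R vector [1, 0, 0] + sin (c * gauss_erf s) *\<^sub>R vector [0, 1, 0] :: real^3"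
  let ?p = "\<lambda>s. (- sin (c * gauss_erf s)) *\<^sub>R vector [1, 0, 0] + cos (c * gauss_erf s) *\<^sub>R vector [0, 1, 0] :: real^3"
  note D = has_vector_derivative_add[OF has_vector_derivative_scaleR[OF _ has_vector_derivative_const]
      has_vector_derivative_scaleR[OF _ has_vector_derivative_const]]
  note E = DERIV_cmult[OF has_field_derivative_gauss_erf, of c]
  have "frenet c 1 ?f ?p (\<lambda>s. vector [0, 0, 1])"
  proof
    show "(?f has_vector_derivative curvature c 1 s *\<^sub>R ?p s) (at s)" for s
      by (rule has_vector_derivative_eq_rhs[OF D[OF DERIV_fun_cos[OF E] DERIV_fun_sin[OF E]]])
        (simp add: curvature_def vec_eq_iff forall_3)
    show "(?p has_vector_derivative - (curvature c 1 s *\<^sub>R ?f s) + torsion 1 s *\<^sub>R vector [0, 0, 1]) (at s)" for s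
      by (rule has_vector_derivative_eq_rhs[OF D[OF DERIV_minus[OF DERIV_fun_sin[OF E]] DERIV_fun_cos[OF E]]])
        (simp add: curvature_def torsion_def vec_eq_iff forall_3)
    show "((\<lambda>s. vector [0, 0, 1]) has_vector_derivative - (torsion 1 s *\<^sub>R ?p s)) (at s)" for s
      by (simp add: torsion_def)
  qed
  then have "profile c 1 = ?f"
    by (rule profile_eqI) (simp_all add: vec_eq_iff forall_3)
  then show ?thesis by simp
qed

lemma profile_limit_1:
  assumes "0 \<le> c"
  shows "profile_limit c 1 = cos (c * sqrt pi) *\<^sub>R vector [1, 0, 0] + sin (c * sqrt pi) *\<^sub>R vector [0, 1, 0]"
proof (rule tendsto_unique[OF _ profile_limit(1)[OF assms]])
  show "(profile c 1 \<longlongrightarrow>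
      cos (c * sqrt pi) *\<^sub>R vector [1, 0, 0] + sin (c * sqrt pi) *\<^sub>R vector [0, 1, 0]) at_top"
    unfolding profile_1 [abs_def] by (intro tendsto_intros gauss_erf_at_top)
qed simp_all

section \<open>Intermediate values of the cosine between the two limits\<close>

definition end_cos :: "real \<Rightarrow> real \<Rightarrow> real" where
  "end_cos c \<alpha> = profile_limit c \<alpha> \<bullet> (half_turn *v profile_limit c \<alpha>)"

lemma end_cos_1:
  assumes "0 \<le> c"
  shows "end_cos c 1 = cos (2 * (c * sqrt pi))"
  using assms by (simp add: end_cos_def profile_limit_1 inner_vec_def sum_3 cos_double power2_eq_square)

lemma continuous_on_end_cos:
  assumes "0 < a"
  shows "continuous_on ({0..C} \<times> {a..}) (\<lambda>z. end_cos (fst z) (snd z))"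
  unfolding end_cos_def using continuous_on_profile_limit[OF assms]
  by (intro continuous_intros bounded_linear.continuous_on[OF matrix_vector_mul_bounded_linear])

text \<open>The lower bound 1/2 serves only to keep \<alpha> away from 0, where the uniform tail
  estimate degenerates.\<close>

lemma end_cos_near_1:
  assumes "0 \<le> c" and "open U" and "end_cos c 1 \<in> U"
  shows "\<exists>d>0. \<forall>\<alpha>\<in>{1 / 2..1}. 1 - \<alpha> < d \<longrightarrow> end_cos c \<alpha> \<in> U"
proof -
  have "continuous_on {1 / 2..1} (\<lambda>\<alpha>. end_cos (fst (c, \<alpha>)) (snd (c, \<alpha>)))"
    using assms(1) by (intro continuous_on_compose2[OF continuous_on_end_cos[of "1 / 2" c]] continuous_intros) auto
  then have "((\<lambda>\<alpha>. end_cos c \<alpha>) \<longlongrightarrow> end_cos c 1) (at 1 within {1 / 2..1})"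
    by (simp add: continuous_on_def)
  then have "\<forall>\<^sub>F \<alpha> in at 1 within {1 / 2..1}. end_cos c \<alpha> \<in> U"
    using assms(2,3) by (rule topological_tendstoD)
  then obtain d where d: "0 < d" "\<And>\<alpha>. \<alpha> \<in> {1 / 2..1} \<Longrightarrow> \<alpha> \<noteq> 1 \<Longrightarrow> dist \<alpha> 1 < d \<Longrightarrow> end_cos c \<alpha> \<in> U"
    unfolding eventually_at by blast
  have "end_cos c \<alpha> \<in> U" if "\<alpha> \<in> {1 / 2..1}" "1 - \<alpha> < d" for \<alpha>
    using d(2)[of \<alpha>] that assms(3) by (cases "\<alpha> = 1") (auto simp: dist_real_def)
  then show ?thesis using d(1) by blast
qed

text \<open>At \<open>\<alpha> = 1\<close> the function \<open>c \<mapsto> end_cos c \<alpha>\<close> takes the value \<open>(-1)\<^sup>l\<close> at \<open>c = l \<surd>\<pi> / 2\<close>; this sign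
  pattern persists at the finitely many points \<open>l \<le> k\<close> for \<open>\<alpha>\<close> near 1.\<close>

lemma end_cos_solutions:
  assumes "- 1 < \<gamma>" "\<gamma> < 1"
  shows "\<exists>a\<in>{0<..<1}. \<forall>\<alpha>\<in>{a..1}. \<forall>l<k. \<exists>c. real l * (sqrt pi / 2) < c \<and>
    c < real (Suc l) * (sqrt pi / 2) \<and> end_cos c \<alpha> = \<gamma>"
proof -
  define x where "x l = real l * (sqrt pi / 2)" for l
  \<comment> \<open>Lying in \<open>U l\<close> records the side of \<gamma>; these sets are open,
    so membership is stable, and their sides alternate.\<close>
  define U where "U l = (if even l then {\<gamma><..} else {..<\<gamma>})" for l :: nat
  have x0: "0 \<le> x l" for l
    by (simp add: x_def)
  have "end_cos (x l) 1 \<in> U l" for l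
  proof -
    have "2 * (x l * sqrt pi) = real l * pi"
      by (simp add: x_def)
    then show ?thesis
      using assms by (simp add: end_cos_1[OF x0] U_def cos_npi)
  qed
  moreover have "open (U l)" for l
    by (simp add: U_def)
  ultimately have "\<exists>d>0. \<forall>\<alpha>\<in>{1 / 2..1}. 1 - \<alpha> < d \<longrightarrow> end_cos (x l) \<alpha> \<in> U l" for l
    using end_cos_near_1[OF x0] by blast
  then obtain d where d: "\<And>l. 0 < d l"
    "\<And>l \<alpha>. \<alpha> \<in> {1 / 2..1} \<Longrightarrow> 1 - \<alpha> < d l \<Longrightarrow> end_cos (x l) \<alpha> \<in> U l"
    by metis
  \<comment> \<open>The inserted 1 keeps \<open>1 - e / 2\<close> at least 1/2, and halving
    \<open>e\<close> later makes \<open>1 - \<alpha> < d l\<close> strict. The index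
    \<open>k\<close> is included because k intervals have k + 1 end points.\<close>
  define e where "e = Min (insert 1 (d ` {..k}))"
  have e: "0 < e" "e \<le> 1" "e \<le> d l" if "l \<le> k" for l
  proof -
    show "0 < e" "e \<le> 1"
      unfolding e_def using d(1) by auto
    show "e \<le> d l"
      unfolding e_def using that by (intro Min_le) auto
  qed
  have "\<exists>c. x l < c \<and> c < x (Suc l) \<and> end_cos c \<alpha> = \<gamma>"
    if \<alpha>: "\<alpha> \<in> {1 - e / 2..1}" and l: "l < k" for \<alpha> l
  proof -
    have "\<alpha> \<in> {1 / 2..1}"
      using \<alpha> e(1,2)[of 0] by auto
    moreover have "1 - \<alpha> < d l" "1 - \<alpha> < d (Suc l)"
      using \<alpha> e(1)[of 0] e(3)[of l] e(3)[of "Suc l"] l by auto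
    ultimately have U: "end_cos (x l) \<alpha> \<in> U l" "end_cos (x (Suc l)) \<alpha> \<in> U (Suc l)"
      using d(2) by blast+
    have le: "x l \<le> x (Suc l)"
      by (simp add: x_def mult_right_mono)
    have "continuous_on {x l..x (Suc l)} (\<lambda>c. end_cos (fst (c, \<alpha>)) (snd (c, \<alpha>)))"
      using x0[of l] \<open>\<alpha> \<in> {1 / 2..1}\<close>
      by (intro continuous_on_compose2[OF continuous_on_end_cos[of "1 / 2" "x (Suc l)"]] continuous_intros) auto
    then have cont: "continuous_on {x l..x (Suc l)} (\<lambda>c. end_cos c \<alpha>)"
      by simp
    have "\<exists>c\<ge>x l. c \<le> x (Suc l) \<and> end_cos c \<alpha> = \<gamma>"
    proof (cases "even l")
      case True
      then show ?thesis
        using U by (intro IVT2'[OF _ _ le cont]) (auto simp: U_def)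
    next
      case False
      then show ?thesis
        using U by (intro IVT'[OF _ _ le cont]) (auto simp: U_def)
    qed
    then obtain c where c: "x l \<le> c" "c \<le> x (Suc l)" "end_cos c \<alpha> = \<gamma>"
      by blast
    \<comment> \<open>Both end values differ from \<gamma>. Solutions in adjacent intervals are
      therefore distinct.\<close>
    moreover have "c \<noteq> x l" "c \<noteq> x (Suc l)"
      using U c(3) by (auto simp: U_def split: if_splits)
    ultimately show ?thesis
      by (intro exI[of _ c]) auto
  qed
  then show ?thesis
    using e(1,2)[of 0] unfolding x_def by (intro bexI[of _ "1 - e / 2"]) auto
qed

section \<open>Rotations between pairs of unit vectors, and separation of rotated profiles\<close>

definition frame_matrix :: "real^3 \<Rightarrow> real^3 \<Rightarrow> real^3^3" where
  "frame_matrix X Y = transpose (vector [X, Y, cross3 X Y])"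

lemma frame_matrix_mult:
  "frame_matrix X Y *v v = v $ 1 *\<^sub>R X + v $ 2 *\<^sub>R Y + v $ 3 *\<^sub>R cross3 X Y"
  by (simp add: frame_matrix_def transpose_def matrix_vector_mult_def vec_eq_iff sum_3 mult.commute)

lemma rotation_matrix_frame_matrix:
  assumes "norm X = 1" "norm Y = 1" "X \<bullet> Y = 0"
  shows "rotation_matrix (frame_matrix X Y)"
proof -
  have "(norm (cross3 X Y))\<^sup>2 = 1"
    using norm_cross[of X Y] assms by simp
  then have "norm (cross3 X Y) = 1"
    by (simp add: abs_square_eq_1)
  then have "orthogonal_matrix (vector [X, Y, cross3 X Y] :: real^3^3)"
    unfolding orthogonal_matrix_orthonormal_rows
    using assms by (simp add: forall_3 row_def orthogonal_def dot_cross_self inner_commute)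
  moreover have "det (vector [X, Y, cross3 X Y]) = 1"
    unfolding dot_cross_det[symmetric] Lagrange using assms
    by (simp add: inner_simps inner_commute norm_eq_1)
  ultimately show ?thesis
    by (simp add: rotation_matrix_def frame_matrix_def orthogonal_matrix_transpose det_transpose)
qed

text \<open>One Gram-Schmidt step; the length of the orthogonal part is the sine of the
  angle.\<close>

lemma unit_vector_decomposition:
  fixes u v :: "real^3"
  assumes "norm u = 1" "norm v = 1"
  obtains n where "norm n = 1" and "u \<bullet> n = 0" and "v = (u \<bullet> v) *\<^sub>R u + sqrt (1 - (u \<bullet> v)\<^sup>2) *\<^sub>R n"
proof -
  define w where "w = v - (u \<bullet> v) *\<^sub>R u"
  have uu: "u \<bullet> u = 1" "v \<bullet> v = 1"
    using assms by (simp_all add: norm_eq_1)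
  have "(norm w)\<^sup>2 = 1 - (u \<bullet> v)\<^sup>2"
    unfolding power2_norm_eq_inner w_def
    by (simp add: inner_simps uu inner_commute power2_eq_square)
  then have w: "norm w = sqrt (1 - (u \<bullet> v)\<^sup>2)"
    by (metis norm_ge_zero real_sqrt_unique)
  have uw: "u \<bullet> w = 0"
    by (simp add: w_def inner_simps uu)
  show ?thesis
  proof (cases "w = 0")
    case True
    \<comment> \<open>The vectors are parallel here, so the sine coefficient is 0 and any orthogonal
      direction will do.\<close>
    obtain y where y: "y \<noteq> 0" "orthogonal u y"
      by (rule orthogonal_to_vector_exists[of u]) auto
    show ?thesis
    proof
      show "norm (sgn y) = 1"
        using y by (simp add: norm_sgn)
      show "u \<bullet> sgn y = 0"
        using y by (simp add: sgn_div_norm orthogonal_def)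
      show "v = (u \<bullet> v) *\<^sub>R u + sqrt (1 - (u \<bullet> v)\<^sup>2) *\<^sub>R sgn y"
        using True w by (simp add: w_def)
    qed
  next
    case False
    show ?thesis
    proof
      show "norm (sgn w) = 1"
        using False by (simp add: norm_sgn)
      show "u \<bullet> sgn w = 0"
        using uw by (simp add: sgn_div_norm)
      have "norm w *\<^sub>R sgn w = w"
        using False by (simp add: sgn_div_norm)
      then show "v = (u \<bullet> v) *\<^sub>R u + sqrt (1 - (u \<bullet> v)\<^sup>2) *\<^sub>R sgn w"
        unfolding w[symmetric] by (simp add: w_def)
    qed
  qed
qed

text \<open>Both pairs are completed to oriented orthonormal frames. Equal inner products mean that
  the second vectors have the same coordinates in the two frames, also when a pair is
  parallel.\<close>

lemma rotation_exists_two: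
  fixes u v A B :: "real^3"
  assumes "norm u = 1" "norm v = 1" "norm A = 1" "norm B = 1" and eq: "u \<bullet> v = A \<bullet> B"
  obtains R where "rotation_matrix R" and "R *v u = A" and "R *v v = B"
proof -
  obtain n where n: "norm n = 1" "u \<bullet> n = 0" "v = (u \<bullet> v) *\<^sub>R u + sqrt (1 - (u \<bullet> v)\<^sup>2) *\<^sub>R n"
    using unit_vector_decomposition[OF assms(1,2)] .
  obtain N where N: "norm N = 1" "A \<bullet> N = 0" "B = (A \<bullet> B) *\<^sub>R A + sqrt (1 - (A \<bullet> B)\<^sup>2) *\<^sub>R N"
    using unit_vector_decomposition[OF assms(3,4)] .
  let ?M = "frame_matrix u n" and ?N = "frame_matrix A N"
  have M: "rotation_matrix ?M" and N': "rotation_matrix ?N"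
    using n N assms by (simp_all add: rotation_matrix_frame_matrix)
  define R where "R = ?N ** transpose ?M"
  have MM: "transpose ?M *v (?M *v w) = w" for w
    using M by (simp add: rotation_matrix_def orthogonal_matrix matrix_vector_mul_assoc)
  have R: "R *v (?M *v w) = ?N *v w" for w
    unfolding R_def matrix_vector_mul_assoc[symmetric] MM ..
  show ?thesis
  proof
    show "rotation_matrix R"
      using M N' by (simp add: R_def rotation_matrix_def orthogonal_matrix_mul
          orthogonal_matrix_transpose det_mul det_transpose)
    show u: "R *v u = A"
      using R[of "vector [1, 0, 0]"] by (simp add: frame_matrix_mult)
    have n': "R *v n = N"
      using R[of "vector [0, 1, 0]"] by (simp add: frame_matrix_mult)
    have "R *v v = (u \<bullet> v) *\<^sub>R A + sqrt (1 - (u \<bullet> v)\<^sup>2) *\<^sub>R N"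
      by (subst n(3)) (simp add: matrix_vector_right_distrib matrix_vector_mult_scaleR u n')
    then show "R *v v = B"
      using N(3) eq by simp
  qed
qed

text \<open>At the point (0, 1) the profile is at its initial frame: the value there shows the image
  of the first vector, and the space derivative c times the image of the second.\<close>

lemma rotated_m_ss_eq_imp:
  assumes "rotation_matrix R1" "rotation_matrix R2"
    and eq: "\<forall>z\<in>half_plane. R1 *v m_ss c1 \<alpha> z = R2 *v m_ss c2 \<alpha> z"
  shows "R1 *v vector [1, 0, 0] = R2 *v vector [1, 0, 0]"
    and "c1 *\<^sub>R (R1 *v vector [0, 1, 0]) = c2 *\<^sub>R (R2 *v vector [0, 1, 0])"
proof -
  have dx: "dx (\<lambda>z. R *v m_ss c \<alpha> z) (0, 1) = c *\<^sub>R (R *v vector [0, 1, 0])"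
    if "rotation_matrix R" for R c
  proof -
    obtain p q where F: "frenet_frame c \<alpha> (profile c \<alpha>) p q" and p: "p 0 = vector [0, 1, 0]"
      by (rule profile_frame)
    interpret frenet_frame c \<alpha> "\<lambda>s. R *v profile c \<alpha> s" "\<lambda>s. R *v p s" "\<lambda>s. R *v q s"
      using F that by (rule frenet_frame.frenet_frame_rotate)
    have "(\<lambda>z. R *v m_ss c \<alpha> z) = parabolic (\<lambda>s. R *v profile c \<alpha> s)"
      by (simp add: m_ss_eq_parabolic parabolic_def fun_eq_iff)
    then show ?thesis
      by (simp add: dx_parabolic p curvature_def)
  qed
  have "dx (\<lambda>z. R1 *v m_ss c1 \<alpha> z) (0, 1) = dx (\<lambda>z. R2 *v m_ss c2 \<alpha> z) (0, 1)"
    using eq by (simp add: dx_def)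
  then show "c1 *\<^sub>R (R1 *v vector [0, 1, 0]) = c2 *\<^sub>R (R2 *v vector [0, 1, 0])"
    using assms by (simp add: dx)
  have "profile c \<alpha> 0 = vector [1, 0, 0]" for c
    by (rule profile_frame)
  then show "R1 *v vector [1, 0, 0] = R2 *v vector [1, 0, 0]"
    using eq[rule_format, of "(0, 1)"] by (simp add: m_ss_def)
qed

lemma norm_rotation_matrix_mult:
  fixes R :: "real^3^3"
  assumes "rotation_matrix R"
  shows "norm (R *v v) = norm v"
  using assms orthogonal_transformation_norm[of "(*v) R"]
  by (simp add: rotation_matrix_def orthogonal_transformation_matrix)

section \<open>Self-similar solutions\<close>

lemma inner_unit_vectors_bounds:
  assumes "norm A = 1" "norm B = 1"
  shows "- 1 \<le> A \<bullet> B" "A \<bullet> B \<le> 1"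
  using Cauchy_Schwarz_ineq2[of A B] assms by auto

text \<open>Taking the j-th value from the j-th of the consecutive intervals of length sqrt pi / 2
  yields positivity, strict growth and divergence at once.\<close>

lemma many_solutions:
  fixes Ap Am :: "real^3"
  assumes unit: "norm Ap = 1" "norm Am = 1" and angle: "- 1 < Ap \<bullet> Am" "Ap \<bullet> Am < 1"
  shows "\<exists>(a :: nat \<Rightarrow> real) (c :: nat \<Rightarrow> real \<Rightarrow> nat \<Rightarrow> real).
          (\<forall>k\<ge>1. a k \<in> {0<..<1} \<and>
            (\<forall>\<alpha>\<in>{a k..1}.
               (\<forall>j\<in>{1..k}. 0 < c k \<alpha> j) \<and> strict_mono_on {1..k} (c k \<alpha>) \<and>
               (\<exists>(m :: nat \<Rightarrow> real \<times> real \<Rightarrow> real^3) (R :: nat \<Rightarrow> real^3^3).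
                  distinct_on_half_plane {1..k} m \<and>
                  (\<forall>j\<in>{1..k}.
                     ss_solution \<alpha> Ap Am (m j) \<and>
                     rotation_matrix (R j) \<and>
                     (\<forall>z\<in>half_plane. m j z = R j *v m_ss (c k \<alpha> j) \<alpha> z) \<and>
                     (\<forall>t>0. ennreal (sqrt t) * Linf_norm (\<lambda>x. dx (m j) (x, t))
                        = ennreal (c k \<alpha> j)))))) \<and>
          (\<forall>M. \<exists>K\<ge>1. \<forall>k\<ge>K. \<forall>\<alpha>\<in>{a k..1}. M \<le> c k \<alpha> k)"
proof -
  define P where "P \<alpha> l c \<longleftrightarrow> real l * (sqrt pi / 2) < c \<and> c < real (Suc l) * (sqrt pi / 2) \<and>
    end_cos c \<alpha> = Ap \<bullet> Am" for \<alpha> l c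
  have "\<exists>a\<in>{0<..<1}. \<forall>\<alpha>\<in>{a..1}. \<forall>l<k. \<exists>c. P \<alpha> l c" for k
    unfolding P_def using end_cos_solutions[OF angle] by blast
  then obtain a where a: "\<And>k. a k \<in> {0<..<1}"
    "\<And>k \<alpha> l. \<alpha> \<in> {a k..1} \<Longrightarrow> l < k \<Longrightarrow> \<exists>c. P \<alpha> l c"
    by metis
  \<comment> \<open>The values are numbered from 1 and the intervals from 0. The choice itself is
    the same for all k; only the range of admissible \<alpha> changes.\<close>
  define c where "c k \<alpha> j = (SOME c. P \<alpha> (j - 1) c)" for k :: nat and \<alpha> j
  have c: "P \<alpha> (j - 1) (c k \<alpha> j)" if "\<alpha> \<in> {a k..1}" "j \<in> {1..k}" for k \<alpha> j
    unfolding c_def by (rule someI_ex) (use a(2)[OF that(1), of "j - 1"] that(2) in auto)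
  have pos: "0 < c k \<alpha> j" if "\<alpha> \<in> {a k..1}" "j \<in> {1..k}" for k \<alpha> j
  proof (rule order_le_less_trans)
    show "real (j - 1) * (sqrt pi / 2) < c k \<alpha> j"
      using c[OF that] by (simp add: P_def)
  qed simp
  have less: "c k \<alpha> i < c k \<alpha> j" if "\<alpha> \<in> {a k..1}" "i \<in> {1..k}" "j \<in> {1..k}" "i < j" for k \<alpha> i j
  proof -
    have "c k \<alpha> i < real i * (sqrt pi / 2)"
      using c[OF that(1,2)] that(2) by (simp add: P_def)
    also have "\<dots> \<le> real (j - 1) * (sqrt pi / 2)"
      using that by (intro mult_right_mono) auto
    also have "\<dots> < c k \<alpha> j"
      using c[OF that(1,3)] by (simp add: P_def)
    finally show ?thesis .
  qed
  have sols: "\<exists>m R. distinct_on_half_plane {1..k} m \<and>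
      (\<forall>j\<in>{1..k}. ss_solution \<alpha> Ap Am (m j) \<and> rotation_matrix (R j) \<and>
        (\<forall>z\<in>half_plane. m j z = R j *v m_ss (c k \<alpha> j) \<alpha> z) \<and>
        (\<forall>t>0. ennreal (sqrt t) * Linf_norm (\<lambda>x. dx (m j) (x, t)) = ennreal (c k \<alpha> j)))"
    if \<alpha>: "\<alpha> \<in> {a k..1}" for k \<alpha>
  proof -
    have \<alpha>': "0 < \<alpha>" "\<alpha> \<le> 1"
      using \<alpha> a(1)[of k] by auto
    have "\<exists>R. rotation_matrix R \<and> R *v profile_limit (c k \<alpha> j) \<alpha> = Ap \<and>
        R *v (half_turn *v profile_limit (c k \<alpha> j) \<alpha>) = Am" if j: "j \<in> {1..k}" for j
    proof -
      have n: "norm (profile_limit (c k \<alpha> j) \<alpha>) = 1"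
        using pos[OF \<alpha> j] \<alpha>' by (intro norm_profile_limit) auto
      have "profile_limit (c k \<alpha> j) \<alpha> \<bullet> (half_turn *v profile_limit (c k \<alpha> j) \<alpha>) = Ap \<bullet> Am"
        using c[OF \<alpha> j] by (simp add: P_def end_cos_def)
      moreover have "norm (half_turn *v profile_limit (c k \<alpha> j) \<alpha>) = 1"
        by (simp add: norm_rotation_matrix_mult rotation_matrix_half_turn n)
      ultimately show ?thesis
        using rotation_exists_two[OF n _ unit] by metis
    qed
    then obtain R where R: "\<And>j. j \<in> {1..k} \<Longrightarrow> rotation_matrix (R j)"
      "\<And>j. j \<in> {1..k} \<Longrightarrow> R j *v profile_limit (c k \<alpha> j) \<alpha> = Ap"
      "\<And>j. j \<in> {1..k} \<Longrightarrow> R j *v (half_turn *v profile_limit (c k \<alpha> j) \<alpha>) = Am"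
      by metis
    define m where "m j = (\<lambda>z. R j *v m_ss (c k \<alpha> j) \<alpha> z)" for j
    have "i = j" if ij: "i \<in> {1..k}" "j \<in> {1..k}" and eq: "\<forall>z\<in>half_plane. m i z = m j z" for i j
    proof -
      have "c k \<alpha> i *\<^sub>R (R i *v vector [0, 1, 0]) = c k \<alpha> j *\<^sub>R (R j *v vector [0, 1, 0])"
        using rotated_m_ss_eq_imp(2)[OF R(1)[OF ij(1)] R(1)[OF ij(2)]] eq unfolding m_def by blast
      \<comment> \<open>Rotations preserve length, so the norms isolate the speeds, which are
        positive and strictly increasing in the index.\<close>
      then have "norm (c k \<alpha> i *\<^sub>R (R i *v vector [0, 1, 0])) = norm (c k \<alpha> j *\<^sub>R (R j *v vector [0, 1, 0]))"
        by simp
      moreover have "norm (vector [0, 1, 0] :: real^3) = 1"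
        by (simp add: norm_eq_1 inner_vec_def sum_3)
      ultimately have "c k \<alpha> i = c k \<alpha> j"
        using pos[OF \<alpha> ij(1)] pos[OF \<alpha> ij(2)] by (simp add: norm_rotation_matrix_mult[OF R(1)[OF ij(1)]] norm_rotation_matrix_mult[OF R(1)[OF ij(2)]])
      then show "i = j"
        using less[OF \<alpha> ij] less[OF \<alpha> ij(2,1)] by (metis less_irrefl nat_neq_iff)
    qed
    then have "distinct_on_half_plane {1..k} m"
      unfolding distinct_on_half_plane_def by blast
    moreover have "ss_solution \<alpha> Ap Am (m j) \<and> rotation_matrix (R j) \<and>
        (\<forall>z\<in>half_plane. m j z = R j *v m_ss (c k \<alpha> j) \<alpha> z) \<and>
        (\<forall>t>0. ennreal (sqrt t) * Linf_norm (\<lambda>x. dx (m j) (x, t)) = ennreal (c k \<alpha> j))"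
      if "j \<in> {1..k}" for j
      using ss_solution_rotated_m_ss[OF less_imp_le[OF pos[OF \<alpha> that]] \<alpha>' R(1)[OF that] R(2)[OF that] R(3)[OF that]]
        R(1)[OF that] unfolding m_def by blast
    ultimately show ?thesis
      by blast
  qed
  have "\<exists>K\<ge>1. \<forall>k\<ge>K. \<forall>\<alpha>\<in>{a k..1}. M \<le> c k \<alpha> k" for M
  proof -
    obtain N :: nat where N: "M \<le> real N * (sqrt pi / 2)"
      using real_arch_simple[of "M / (sqrt pi / 2)"] by (auto simp: field_simps)
    have "M \<le> c k \<alpha> k" if "Suc N \<le> k" "\<alpha> \<in> {a k..1}" for k \<alpha>
    proof -
      have "real N * (sqrt pi / 2) \<le> real (k - 1) * (sqrt pi / 2)"
        using that by (intro mult_right_mono) auto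
      moreover have "real (k - 1) * (sqrt pi / 2) < c k \<alpha> k"
        using c[OF that(2), of k] that(1) by (simp add: P_def)
      ultimately show ?thesis
        using N by linarith
    qed
    then show ?thesis
      by (intro exI[of _ "Suc N"]) auto
  qed
  then show ?thesis
    using a(1) pos less sols by (intro exI[of _ a] exI[of _ c]) (simp add: strict_mono_on_def)
qed

text \<open>In the plane spanned by \<open>Ap\<close> and \<open>Am\<close> the solutions for \<open>\<alpha> = 1\<close> are rotations by the angle
  \<open>d (\<surd>\<pi> - Erf s)\<close>, where the signed speed \<open>d\<close> runs through \<open>l \<surd>\<pi> + \<theta> / (2 \<surd>\<pi>)\<close> for integers \<open>l\<close>
  and \<open>c = \<bar>d\<bar>\<close>; this keeps the solutions apart even where the values \<open>c\<close> coincide (\<open>\<theta> = 0\<close> or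
  \<open>\<theta> = \<pi>\<close>).\<close>

lemma infinitely_many_solutions:
  fixes Ap Am :: "real^3" and \<theta> :: real
  assumes unit: "norm Ap = 1" "norm Am = 1" and \<theta>: "\<theta> = unit_angle Ap Am"
  shows "\<exists>c :: nat \<Rightarrow> real.
          (\<forall>l\<ge>0. c (2 * l + 1) = real l * sqrt pi + \<theta> / (2 * sqrt pi)) \<and>
          (\<forall>l\<ge>1. c (2 * l) = real l * sqrt pi - \<theta> / (2 * sqrt pi)) \<and>
          (\<exists>(m :: nat \<Rightarrow> real \<times> real \<Rightarrow> real^3) (R :: nat \<Rightarrow> real^3^3).
             distinct_on_half_plane {1..} m \<and>
             (\<forall>j\<ge>1.
                ss_solution 1 Ap Am (m j) \<and>
                rotation_matrix (R j) \<and>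
                (\<forall>z\<in>half_plane. m j z = R j *v m_ss (c j) 1 z) \<and>
                (\<forall>t>0. ennreal (sqrt t) * Linf_norm (\<lambda>x. dx (m j) (x, t)) = ennreal (c j))))"
proof -
  \<comment> \<open>For parallel data the direction \<open>n\<close> is arbitrary, but it is fixed
    once, so that all solutions move in the same plane.\<close>
  obtain n where n: "norm n = 1" "Ap \<bullet> n = 0"
    and Am: "Am = (Ap \<bullet> Am) *\<^sub>R Ap + sqrt (1 - (Ap \<bullet> Am)\<^sup>2) *\<^sub>R n"
    using unit_vector_decomposition[OF unit] .
  note bounds = inner_unit_vectors_bounds[OF unit]
  have \<theta>': "0 \<le> \<theta>" "\<theta> \<le> pi" and Am': "Am = cos \<theta> *\<^sub>R Ap + sin \<theta> *\<^sub>R n"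
    using Am bounds by (simp_all add: \<theta> unit_angle_def arccos_lbound arccos_ubound cos_arccos sin_arccos)
  have nn: "Ap \<bullet> Ap = 1" "n \<bullet> n = 1" "n \<bullet> Ap = 0"
    using unit n by (simp_all add: norm_eq_1 inner_commute)
  \<comment> \<open>An enumeration of the integers: odd indices give 0, 1, 2, ... and even ones -1,
    -2, .... The factor \<open>\<sigma>\<close> restores the sign, so that \<open>c j\<close> is
    nonnegative.\<close>
  define N :: "nat \<Rightarrow> int" where "N j = (if odd j then int (j div 2) else - int (j div 2))" for j
  define \<sigma> :: "nat \<Rightarrow> real" where "\<sigma> j = (if odd j then 1 else - 1)" for j
  define d where "d j = of_int (N j) * sqrt pi + \<theta> / (2 * sqrt pi)" for j
  define c where "c j = \<sigma> j * d j" for j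
  \<comment> \<open>Index 0 is excluded because \<open>N 0\<close> and \<open>N 1\<close>
    coincide.\<close>
  have N_inj: "i = j" if "N i = N j" "1 \<le> i" "1 \<le> j" for i j
    using that by (auto simp: N_def split: if_splits elim!: oddE evenE)
  have \<sigma>: "\<sigma> j * \<sigma> j = 1" for j
    by (simp add: \<sigma>_def)
  have c\<sigma>: "c j * \<sigma> j = d j" for j
    using \<sigma>[of j] by (simp add: c_def mult_ac)
  have d_pi: "2 * (d j * sqrt pi) = 2 * pi * of_int (N j) + \<theta>" for j
    by (simp add: d_def field_simps)
  have cos_d: "cos (2 * (d j * sqrt pi)) = cos \<theta>" and sin_d: "sin (2 * (d j * sqrt pi)) = sin \<theta>" for j
    unfolding d_pi by (simp_all add: cos_add sin_add)
  have c_odd: "c (2 * l + 1) = real l * sqrt pi + \<theta> / (2 * sqrt pi)" for l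
    by (simp add: c_def \<sigma>_def d_def N_def)
  have c_even: "c (2 * l) = real l * sqrt pi - \<theta> / (2 * sqrt pi)" for l
    by (simp add: c_def \<sigma>_def d_def N_def)
  have c_nonneg: "0 \<le> c j" if "1 \<le> j" for j
  proof (cases "odd j")
    case True
    then obtain l where "j = 2 * l + 1" by (rule oddE)
    then show ?thesis using c_odd[of l] \<theta>' by simp
  next
    case False
    then obtain l where l: "j = 2 * l" by (auto elim: evenE)
    \<comment> \<open>Even indices from 2 on have \<open>l\<close> at least 1, and \<theta> at most
      pi then keeps the difference nonnegative.\<close>
    have "\<theta> / (2 * sqrt pi) \<le> pi / (2 * sqrt pi)"
      using \<theta>' by (intro divide_right_mono) auto
    also have "\<dots> = sqrt pi / 2"
      by (simp add: field_simps)
    also have "\<dots> \<le> real l * sqrt pi"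
      using l that by (cases l) (auto simp: algebra_simps)
    finally show ?thesis using l c_even[of l] by simp
  qed
  define C S where "C j = cos (d j * sqrt pi)" and "S j = sin (d j * sqrt pi)" for j
  have CS: "C j * C j + S j * S j = 1" for j
    by (simp add: C_def S_def flip: power2_eq_square)
  have cos_c: "cos (c j * sqrt pi) = C j" and sin_c: "sin (c j * sqrt pi) = \<sigma> j * S j" for j
    by (simp_all add: C_def S_def c_def \<sigma>_def)
  \<comment> \<open>Position and direction of motion at s = 0: \<open>X j\<close> is
    \<open>Ap\<close> turned by \<open>d j * sqrt pi\<close> towards \<open>n\<close>, and the curve
    turns back to \<open>Ap\<close> as s grows. Towards minus infinity it reaches angle
    \<open>2 * (d j * sqrt pi)\<close>, which is \<theta> modulo 2 pi.\<close>
  define X Y where "X j = C j *\<^sub>R Ap + S j *\<^sub>R n" and "Y j = \<sigma> j *\<^sub>R (S j *\<^sub>R Ap - C j *\<^sub>R n)" for j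
  define R where "R j = frame_matrix (X j) (Y j)" for j
  have R: "rotation_matrix (R j)" for j
    unfolding R_def
  proof (rule rotation_matrix_frame_matrix)
    show "norm (X j) = 1"
      using CS[of j] by (simp add: X_def norm_eq_1 inner_simps nn n)
    have "S j * S j + C j * C j = 1"
      using CS[of j] by simp
    then show "norm (Y j) = 1"
      by (simp add: Y_def \<sigma>_def norm_eq_1 inner_simps nn n)
    show "X j \<bullet> Y j = 0"
      by (simp add: X_def Y_def inner_simps nn n)
  qed
  have comb: "a *\<^sub>R u + b *\<^sub>R v + (a' *\<^sub>R u - b' *\<^sub>R v) = (a + a') *\<^sub>R u + (b - b') *\<^sub>R v"
    for a b a' b' and u v :: "real^3"
    by (simp add: algebra_simps)
  have lim: "profile_limit (c j) 1 = C j *\<^sub>R vector [1, 0, 0] + (\<sigma> j * S j) *\<^sub>R vector [0, 1, 0]"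
    if "1 \<le> j" for j
    by (simp add: profile_limit_1[OF c_nonneg[OF that]] cos_c sin_c)
  have R_top: "R j *v profile_limit (c j) 1 = Ap" if "1 \<le> j" for j
  proof -
    have "R j *v profile_limit (c j) 1 = C j *\<^sub>R X j + (\<sigma> j * S j) *\<^sub>R Y j"
      by (simp add: R_def frame_matrix_mult lim[OF that])
    also have "\<dots> = (C j * C j + S j * S j) *\<^sub>R Ap"
      by (cases "odd j") (simp_all add: X_def Y_def \<sigma>_def algebra_simps)
    finally show ?thesis by (simp add: CS)
  qed
  have R_bot: "R j *v (half_turn *v profile_limit (c j) 1) = Am" if "1 \<le> j" for j
  proof -
    have "R j *v (half_turn *v profile_limit (c j) 1) = C j *\<^sub>R X j - (\<sigma> j * S j) *\<^sub>R Y j"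
      by (simp add: R_def frame_matrix_mult lim[OF that])
    also have "\<dots> = (C j * C j - S j * S j) *\<^sub>R Ap + (2 * (S j * C j)) *\<^sub>R n"
      by (cases "odd j") (simp_all add: X_def Y_def \<sigma>_def algebra_simps flip: scaleR_2)
    also have "\<dots> = Am"
      using cos_d[of j] sin_d[of j]
      by (simp add: Am' C_def S_def cos_double sin_double power2_eq_square mult.assoc)
    finally show ?thesis .
  qed
  define m where "m j = (\<lambda>z. R j *v m_ss (c j) 1 z)" for j
  have "i = j" if ij: "1 \<le> i" "1 \<le> j" and eq: "\<forall>z\<in>half_plane. m i z = m j z" for i j
  proof -
    have "X i = X j" and "c i *\<^sub>R Y i = c j *\<^sub>R Y j"
      using rotated_m_ss_eq_imp[OF R R, of i "c i" 1 j "c j"] eq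
      by (simp_all add: m_def R_def frame_matrix_mult)
    then have "X i \<bullet> Ap = X j \<bullet> Ap" "X i \<bullet> n = X j \<bullet> n"
      "(c i *\<^sub>R Y i) \<bullet> Ap = (c j *\<^sub>R Y j) \<bullet> Ap" "(c i *\<^sub>R Y i) \<bullet> n = (c j *\<^sub>R Y j) \<bullet> n"
      by simp_all
    \<comment> \<open>Products with \<sigma> turn the speeds into the signed ones. As cosine and
      sine do not vanish together, \<open>d\<close> is determined even if two values of
      \<open>c\<close> agree.\<close>
    then have CSij: "C i = C j" "S i = S j" and "d i * S i = d j * S j" "d i * C i = d j * C j"
      by (simp_all add: X_def Y_def inner_simps nn n flip: c\<sigma>)
    then have "d i = d j"
      using CS[of j] by auto
    then have "N i = N j"
      by (simp add: d_def)
    then show "i = j"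
      using N_inj ij by blast
  qed
  then have "distinct_on_half_plane {1..} m"
    unfolding distinct_on_half_plane_def by blast
  moreover have "ss_solution 1 Ap Am (m j) \<and> rotation_matrix (R j) \<and>
      (\<forall>z\<in>half_plane. m j z = R j *v m_ss (c j) 1 z) \<and>
      (\<forall>t>0. ennreal (sqrt t) * Linf_norm (\<lambda>x. dx (m j) (x, t)) = ennreal (c j))" if "1 \<le> j" for j
    using ss_solution_rotated_m_ss[OF c_nonneg[OF that] _ _ R R_top[OF that] R_bot[OF that]] R
    unfolding m_def by auto
  ultimately show ?thesis
    using c_odd c_even by (intro exI[of _ c]) blast
qed

theorem theorem1p3:
  fixes Ap Am :: "real^3" and \<theta> :: real
  assumes "Ap \<in> sphere 0 1" and "Am \<in> sphere 0 1"
    and "\<theta> = unit_angle Ap Am"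
  shows
    "(\<theta> \<in> {0<..<pi} \<longrightarrow>
       (\<exists>(a :: nat \<Rightarrow> real) (c :: nat \<Rightarrow> real \<Rightarrow> nat \<Rightarrow> real).
          (\<forall>k\<ge>1. a k \<in> {0<..<1} \<and>
            (\<forall>\<alpha>\<in>{a k..1}.
               (\<forall>j\<in>{1..k}. 0 < c k \<alpha> j) \<and> strict_mono_on {1..k} (c k \<alpha>) \<and>
               (\<exists>(m :: nat \<Rightarrow> real \<times> real \<Rightarrow> real^3) (R :: nat \<Rightarrow> real^3^3).
                  distinct_on_half_plane {1..k} m \<and>
                  (\<forall>j\<in>{1..k}.
                     ss_solution \<alpha> Ap Am (m j) \<and>
                     rotation_matrix (R j) \<and>
                     (\<forall>z\<in>half_plane. m j z = R j *v m_ss (c k \<alpha> j) \<alpha> z) \<and>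
                     (\<forall>t>0. ennreal (sqrt t) * Linf_norm (\<lambda>x. dx (m j) (x, t))
                        = ennreal (c k \<alpha> j)))))) \<and>
          (\<forall>M. \<exists>K\<ge>1. \<forall>k\<ge>K. \<forall>\<alpha>\<in>{a k..1}. M \<le> c k \<alpha> k)))
     \<and>
     (\<theta> \<in> {0..pi} \<longrightarrow>
       (\<exists>c :: nat \<Rightarrow> real.
          (\<forall>l\<ge>0. c (2 * l + 1) = real l * sqrt pi + \<theta> / (2 * sqrt pi)) \<and>
          (\<forall>l\<ge>1. c (2 * l) = real l * sqrt pi - \<theta> / (2 * sqrt pi)) \<and>
          (\<exists>(m :: nat \<Rightarrow> real \<times> real \<Rightarrow> real^3) (R :: nat \<Rightarrow> real^3^3).
             distinct_on_half_plane {1..} m \<and>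
             (\<forall>j\<ge>1.
                ss_solution 1 Ap Am (m j) \<and>
                rotation_matrix (R j) \<and>
                (\<forall>z\<in>half_plane. m j z = R j *v m_ss (c j) 1 z) \<and>
                (\<forall>t>0. ennreal (sqrt t) * Linf_norm (\<lambda>x. dx (m j) (x, t)) = ennreal (c j))))))"
proof (intro conjI impI)
  have unit: "norm Ap = 1" "norm Am = 1"
    using assms by simp_all
  show "\<exists>(a :: nat \<Rightarrow> real) (c :: nat \<Rightarrow> real \<Rightarrow> nat \<Rightarrow> real).
          (\<forall>k\<ge>1. a k \<in> {0<..<1} \<and>
            (\<forall>\<alpha>\<in>{a k..1}.
               (\<forall>j\<in>{1..k}. 0 < c k \<alpha> j) \<and> strict_mono_on {1..k} (c k \<alpha>) \<and>
               (\<exists>(m :: nat \<Rightarrow> real \<times> real \<Rightarrow> real^3) (R :: nat \<Rightarrow> real^3^3).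
                  distinct_on_half_plane {1..k} m \<and>
                  (\<forall>j\<in>{1..k}.
                     ss_solution \<alpha> Ap Am (m j) \<and>
                     rotation_matrix (R j) \<and>
                     (\<forall>z\<in>half_plane. m j z = R j *v m_ss (c k \<alpha> j) \<alpha> z) \<and>
                     (\<forall>t>0. ennreal (sqrt t) * Linf_norm (\<lambda>x. dx (m j) (x, t))
                        = ennreal (c k \<alpha> j)))))) \<and>
          (\<forall>M. \<exists>K\<ge>1. \<forall>k\<ge>K. \<forall>\<alpha>\<in>{a k..1}. M \<le> c k \<alpha> k)"
    if "\<theta> \<in> {0<..<pi}"
  proof (rule many_solutions[OF unit])
    have "Ap \<bullet> Am \<noteq> 1" "Ap \<bullet> Am \<noteq> - 1"
      using that assms(3) by (auto simp: unit_angle_def)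
    then show "- 1 < Ap \<bullet> Am" "Ap \<bullet> Am < 1"
      using inner_unit_vectors_bounds[OF unit] by auto
  qed
qed (rule infinitely_many_solutions, use assms in simp_all)

end
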